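(* Let $m\in\mathbb{N}$, let $w$ be an $A_\infty$ weight on $\mathbb{R}^n$, let $p\ge1$ and $s>1$, and let $a:\mathcal{Q}\to(0,\infty)$ be a functional satisfying the condition $SD^s_p(w)$ with constant $\|a\|$. Let $f$ be a locally integrable function such that $$\frac{1}{|Q|}\int_Q|f-P_Qf|\,dx\le a(Q)$$ for every cube $Q$. Then there exists a constant $C_{n,m}$ depending only on $n$ and $m$ such that for any cube $Q$ $$\left(\frac{1}{w(Q)}\int_Q|f-P_Qf|^p\,w\,dx\right)^{1/p}\le C_{n,m}\,2^{\frac{s+1}{p'}}\,s\,\|a\|^s\,a(Q),$$ where $p'=p/(p-1)$; when $p=1$ the factor $2^{\frac{s+1}{p'}}$ disappears (equals $1$).
   Context: Cubes are cubes in $\mathbb{R}^n$ with sides parallel to the coordinate axes; $\mathcal{Q}$ is the family of all cubes. A weight is a locally integrable non-negative function; $w(E)=\int_E w\,dx$. $A_\infty=\bigcup_{q\ge1}A_q$ is the union of the Muckenhoupt classes (defined with cubes). $\mathcal{P}_m$ is the space of polynomials of degree at most $m$ in $n$ variables. For a cube $Q$, equip $\mathcal{P}_m$ with the inner product $\langle f,g\rangle_Q=\frac{1}{|Q|}\int_Q fg\,dx$ and let $\{\phi_r\}$ be an orthonormal basis; the projection is $P_Qf=\sum_r\left(\frac{1}{|Q|}\int_Q f\phi_r\,dx\right)\phi_r$. For $s>1$, $a$ satisfies $SD^s_p(w)$ if there is a constant $C$ such that for any $L>1$, any cube $Q$ and any family $\{Q_i\}$ of pairwise disjoint subcubes of $Q$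 with $\sum_i|Q_i|\le|Q|/L$, $$\sum_i a(Q_i)^p w(Q_i)\le C^p\left(\frac1L\right)^{p/s}a(Q)^p w(Q).$$ The best possible such $C$ is denoted $\|a\|$. *)

theory Defs
  imports "HOL-Analysis.Analysis"
begin

text \<open>Cubes are half-open.  Then disjointness of cubes in the literal sense is the same as
  disjointness of their interiors, and the dyadic children of a cube are themselves a family of
  pairwise disjoint subcubes.\<close>

definition cubes :: "(real^'n) set set" where
  "cubes = {{x. \<forall>i. c $ i \<le> x $ i \<and> x $ i < c $ i + l} | c l. 0 < l}"

definition average :: "(real^'n) set \<Rightarrow> (real^'n \<Rightarrow> real) \<Rightarrow> real" where
  "average Q g = (LINT x:Q|lebesgue. g x) / measure lebesgue Q"

definition locally_integrable :: "(real^'n \<Rightarrow> real) \<Rightarrow> bool" where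
  "locally_integrable f \<longleftrightarrow> (\<forall>K. compact K \<longrightarrow> set_integrable lebesgue K f)"

definition weight :: "(real^'n \<Rightarrow> real) \<Rightarrow> bool" where
  "weight w \<longleftrightarrow> locally_integrable w \<and> (\<forall>x. 0 \<le> w x)"

definition wmeasure :: "(real^'n \<Rightarrow> real) \<Rightarrow> (real^'n) set \<Rightarrow> real" where
  "wmeasure w E = (LINT x:E|lebesgue. w x)"

text \<open>For \<open>q > 1\<close> the Muckenhoupt condition reads
  \<open>sup\<^sub>Q (average Q w) (average Q (w powr (1 - q')))\<^sup>q\<^sup>-\<^sup>1 < \<infinity>\<close> with \<open>q' = q / (q - 1)\<close>; for \<open>q = 1\<close> it
  reads \<open>average Q w \<le> C (ess inf\<^sub>Q w)\<close>.  Mathematically a negative power of \<open>0\<close> is \<open>\<infinity>\<close>, whereas in HOL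
  \<open>0 powr r = 0\<close> and the integral of a non-integrable function is \<open>0\<close>.  Hence positivity
  almost everywhere (automatic unless \<open>w\<close> vanishes almost everywhere, a degenerate case for which
  \<open>1 / w(Q)\<close> is meaningless) and integrability of the dual weight are stated explicitly.\<close>

definition Muckenhoupt :: "real \<Rightarrow> (real^'n \<Rightarrow> real) \<Rightarrow> bool" where
  "Muckenhoupt q w \<longleftrightarrow>
     weight w \<and> (AE x in lebesgue. 0 < w x) \<and>
     (if q = 1
      then \<exists>C. \<forall>Q\<in>cubes. AE x in lebesgue. x \<in> Q \<longrightarrow> average Q w \<le> C * w x
      else (\<forall>Q\<in>cubes. set_integrable lebesgue Q (\<lambda>x. w x powr (1 - q / (q - 1)))) \<and>
           (\<exists>C. \<forall>Q\<in>cubes.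
              average Q w * average Q (\<lambda>x. w x powr (1 - q / (q - 1))) powr (q - 1) \<le> C))"

definition A_infinity :: "(real^'n \<Rightarrow> real) \<Rightarrow> bool" where
  "A_infinity w \<longleftrightarrow> (\<exists>q\<ge>1. Muckenhoupt q w)"

definition poly_space :: "nat \<Rightarrow> (real^'n \<Rightarrow> real) set" where
  "poly_space m =
     {f. \<exists>c. f = (\<lambda>x. \<Sum>\<alpha> | (\<Sum>i\<in>UNIV. \<alpha> i) \<le> m. c \<alpha> * (\<Prod>i\<in>UNIV. x $ i ^ \<alpha> i))}"

definition orthonormal_basis ::
  "nat \<Rightarrow> (real^'n) set \<Rightarrow> (real^'n \<Rightarrow> real) set \<Rightarrow> bool" where
  "orthonormal_basis m Q B \<longleftrightarrow>
     finite B \<and> B \<subseteq> poly_space m \<and>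
     (\<forall>\<phi>\<in>B. \<forall>\<psi>\<in>B. average Q (\<lambda>x. \<phi> x * \<psi> x) = (if \<phi> = \<psi> then 1 else 0)) \<and>
     (\<forall>g\<in>poly_space m. \<exists>c. \<forall>x. g x = (\<Sum>\<phi>\<in>B. c \<phi> * \<phi> x))"

text \<open>The projection does not depend on which orthonormal basis is chosen.\<close>

definition poly_proj ::
  "nat \<Rightarrow> (real^'n) set \<Rightarrow> (real^'n \<Rightarrow> real) \<Rightarrow> real^'n \<Rightarrow> real" where
  "poly_proj m Q f =
     (let B = (SOME B. orthonormal_basis m Q B)
      in (\<lambda>x. \<Sum>\<phi>\<in>B. average Q (\<lambda>y. f y * \<phi> y) * \<phi> x))"

text \<open>A family of pairwise disjoint cubes is rendered as a set of cubes, possibly infinite.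
  Summability has to be demanded separately since \<open>infsum\<close> is \<open>0\<close> on divergent real sums; the
  sum of the Lebesgue measures always converges.\<close>

definition SD_bound ::
  "real \<Rightarrow> real \<Rightarrow> (real^'n \<Rightarrow> real) \<Rightarrow> ((real^'n) set \<Rightarrow> real) \<Rightarrow> real \<Rightarrow> bool" where
  "SD_bound s p w a C \<longleftrightarrow>
     (\<forall>L>1. \<forall>Q\<in>cubes. \<forall>F.
        F \<subseteq> cubes \<and> pairwise disjnt F \<and> (\<forall>R\<in>F. R \<subseteq> Q) \<and>
        (\<Sum>\<^sub>\<infinity>R\<in>F. measure lebesgue R) \<le> measure lebesgue Q / L \<longrightarrow>
        (\<lambda>R. a R powr p * wmeasure w R) summable_on F \<and>
        (\<Sum>\<^sub>\<infinity>R\<in>F. a R powr p * wmeasure w R)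
          \<le> C powr p * (1 / L) powr (p / s) * (a Q powr p * wmeasure w Q))"

definition SD ::
  "real \<Rightarrow> real \<Rightarrow> (real^'n \<Rightarrow> real) \<Rightarrow> ((real^'n) set \<Rightarrow> real) \<Rightarrow> bool" where
  "SD s p w a \<longleftrightarrow> (\<exists>C\<ge>0. SD_bound s p w a C)"

definition SD_norm ::
  "real \<Rightarrow> real \<Rightarrow> (real^'n \<Rightarrow> real) \<Rightarrow> ((real^'n) set \<Rightarrow> real) \<Rightarrow> real" where
  "SD_norm s p w a = Inf {C. 0 \<le> C \<and> SD_bound s p w a C}"

end

theory Submission
  imports Defs
begin

text \<open>Fix a cube \<open>Q\<close> and iterate the Calderon--Zygmund decomposition at height \<open>e a(R)\<close>: the
  children of a cube \<open>R\<close> are its maximal dyadic subcubes on which the average of \<open>\<bar>f - P\<^sub>R f\<bar>\<close> exceeds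
  \<open>e a(R)\<close>.  Since \<open>P\<^sub>R\<^sub>' P\<^sub>R f = P\<^sub>R f\<close>, and since all norms on the polynomials of degree at most \<open>m\<close> are
  comparable on a cube with constants independent of the cube, replacing \<open>P\<^sub>R f\<close> by \<open>P\<^sub>R\<^sub>' f\<close> on a
  child \<open>R'\<close> costs only \<open>K a(R)\<close>.  The cubes of generation \<open>j\<close> cover at most \<open>e\<^sup>-\<^sup>j |Q|\<close>, so almost every
  point lies in only finitely many of them, and \<open>\<bar>f - P\<^sub>Q f\<bar>\<close> is bounded almost everywhere by \<open>K\<close> times
  the sum of \<open>a(R)\<close> over the cubes \<open>R\<close> of all generations that contain the point.  The condition
  \<open>SD\<close> bounds the \<open>L\<^sup>p(w)\<close> norm of the \<open>j\<close>-th summand by \<open>\<parallel>a\<parallel> e\<^sup>-\<^sup>j\<^sup>/\<^sup>s a(Q) w(Q)\<^sup>1\<^sup>/\<^sup>p\<close>; the geometric series is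
  at most \<open>1 + s \<le> 2 s\<close>.  This yields the claim with \<open>\<parallel>a\<parallel>\<close> in place of \<open>\<parallel>a\<parallel>\<^sup>s\<close>, and \<open>\<parallel>a\<parallel> \<ge> 1\<close> because
  otherwise a chain of nested cubes would force \<open>a(R)\<^sup>p w(R) = 0\<close>.\<close>

section \<open>Cubes and dyadic cells\<close>

definition cube :: "real^'n \<Rightarrow> real \<Rightarrow> (real^'n) set" where
  "cube c l = {x. \<forall>i. c $ i \<le> x $ i \<and> x $ i < c $ i + l}"

lemma cubes_eq: "cubes = {cube c l | c l. 0 < l}"
  by (simp add: cubes_def cube_def)

lemma cubesE:
  assumes "Q \<in> cubes"
  obtains c l where "0 < l" "Q = cube c l"
  using assms by (auto simp: cubes_eq)

lemma cubeI [intro]: "0 < l \<Longrightarrow> cube c l \<in> cubes"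
  by (auto simp: cubes_eq)

lemma cube_subset_cbox: "cube c l \<subseteq> cbox c (c + (\<chi> i. l))"
  by (auto simp: cube_def mem_box_cart less_imp_le)

lemma box_subset_cube: "box c (c + (\<chi> i. l)) \<subseteq> cube c l"
  by (auto simp: cube_def mem_box_cart less_imp_le)

lemma cube_borel [measurable]: "cube c l \<in> sets borel"
proof -
  have "cube c l = (\<Inter>i. {x. c $ i \<le> x $ i} \<inter> {x. x $ i < c $ i + l})"
    by (auto simp: cube_def)
  also have "\<dots> \<in> sets borel"
    by (intro sets.countable_INT'' sets.Int borel_closed borel_open
          closed_Collect_le open_Collect_less continuous_intros) auto
  finally show ?thesis .
qed

lemma cubes_borel: "Q \<in> cubes \<Longrightarrow> Q \<in> sets borel"
  by (auto simp: cubes_eq)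

lemma cubes_lebesgue [measurable_dest]: "Q \<in> cubes \<Longrightarrow> Q \<in> sets lebesgue"
  using cubes_borel by (metis sets_completionI_sets sets_lborel)

text \<open>The half-open cube lies between the open and the closed box with the same corners, and
  both have volume l^n.\<close>

lemma emeasure_cube:
  fixes c :: "real^'n"
  assumes "0 < l"
  shows "emeasure lebesgue (cube c l) = ennreal (l ^ CARD('n))"
proof (rule antisym)
  let ?d = "c + (\<chi> i. l)"
  have B: "(\<Prod>b\<in>Basis. (?d - c) \<bullet> b) = l ^ CARD('n)"
    by (simp add: Basis_vec_def inner_axis prod.UNION_disjoint axis_eq_axis)
  have le: "\<forall>b\<in>Basis. c \<bullet> b \<le> ?d \<bullet> b"
    using assms by (auto simp: Basis_vec_def inner_axis)
  have "emeasure lebesgue (cube c l) \<le> emeasure lebesgue (cbox c ?d)"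
    by (intro emeasure_mono cube_subset_cbox) auto
  also have "\<dots> = ennreal (l ^ CARD('n))"
    using le B by (simp add: emeasure_lborel_cbox_eq)
  finally show "emeasure lebesgue (cube c l) \<le> ennreal (l ^ CARD('n))" .
  have "ennreal (l ^ CARD('n)) = emeasure lebesgue (box c ?d)"
    using le B by (simp add: emeasure_lborel_box_eq)
  also have "\<dots> \<le> emeasure lebesgue (cube c l)"
    by (intro emeasure_mono box_subset_cube) auto
  finally show "ennreal (l ^ CARD('n)) \<le> emeasure lebesgue (cube c l)" .
qed

lemma measure_cube:
  fixes c :: "real^'n"
  assumes "0 < l"
  shows "measure lebesgue (cube c l) = l ^ CARD('n)"
  using assms emeasure_cube[OF assms, of c] by (simp only: measure_def enn2real_ennreal zero_le_power less_imp_le)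

lemma cubes_measure_pos: "Q \<in> cubes \<Longrightarrow> 0 < measure lebesgue Q"
  by (metis cubesE measure_cube zero_less_power)

lemma cubes_lmeasurable: "Q \<in> cubes \<Longrightarrow> Q \<in> lmeasurable"
  by (metis cubesE cubes_lebesgue emeasure_cube ennreal_less_top fmeasurableI infinity_ennreal_def)

text \<open>The dyadic grid generated by the cube \<open>cube c l\<close>: \<open>cell c l k x\<close> is the cube of side
  \<open>l / 2 ^ k\<close> of the grid containing \<open>x\<close>.\<close>

definition cell :: "real^'n \<Rightarrow> real \<Rightarrow> nat \<Rightarrow> real^'n \<Rightarrow> (real^'n) set" where
  "cell c l k x = {y. \<forall>i. \<lfloor>2 ^ k * (y $ i - c $ i) / l\<rfloor> = \<lfloor>2 ^ k * (x $ i - c $ i) / l\<rfloor>}"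

lemma mem_cell [simp]: "x \<in> cell c l k x"
  by (simp add: cell_def)

lemma cell_eq: "y \<in> cell c l k x \<Longrightarrow> cell c l k y = cell c l k x"
  by (simp add: cell_def)

lemma cell_eq_cube:
  assumes "0 < l"
  shows "cell c l k x = cube (\<chi> i. c $ i + l / 2 ^ k * of_int \<lfloor>2 ^ k * (x $ i - c $ i) / l\<rfloor>) (l / 2 ^ k)"
proof -
  have "\<lfloor>2 ^ k * (u - v) / l\<rfloor> = z \<longleftrightarrow> v + l / 2 ^ k * of_int z \<le> u \<and> u < v + l / 2 ^ k * of_int z + l / 2 ^ k"
    for u v :: real and z
    using assms by (simp add: floor_eq_iff field_simps)
  then show ?thesis
    unfolding cell_def cube_def by simp
qed

lemma cell_in_cubes: "0 < l \<Longrightarrow> cell c l k x \<in> cubes"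
  by (simp add: cell_eq_cube cubeI)

lemma measure_cell:
  fixes c :: "real^'n"
  shows "0 < l \<Longrightarrow> measure lebesgue (cell c l k x) = (l / 2 ^ k) ^ CARD('n)"
  by (subst cell_eq_cube, assumption, rule measure_cube) simp

lemma cell_0:
  assumes "0 < l" "x \<in> cube c l"
  shows "cell c l 0 x = cube c l"
proof -
  have "\<lfloor>(x $ i - c $ i) / l\<rfloor> = 0" for i
    using assms by (auto simp: floor_eq_iff cube_def field_simps)
  then show ?thesis
    using assms by (simp add: cell_eq_cube vec_lambda_eta)
qed

lemma cell_Suc_subset: "0 < l \<Longrightarrow> cell c l (Suc k) x \<subseteq> cell c l k x"
proof
  fix y assume y: "y \<in> cell c l (Suc k) x" and "0 < l"
  \<comment> \<open>Halving a real number halves its floor by integer division, so the grid index at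
    level \<open>k\<close> is determined by the index at level \<open>Suc k\<close>.\<close>
  have half: "\<lfloor>2 ^ k * u / l\<rfloor> = \<lfloor>2 ^ Suc k * u / l\<rfloor> div 2" for u
    using floor_divide_real_eq_div[of 2 "2 ^ Suc k * u / l"] by simp
  show "y \<in> cell c l k x"
    using y unfolding cell_def mem_Collect_eq half by simp
qed

lemma cell_antimono: "0 < l \<Longrightarrow> j \<le> k \<Longrightarrow> cell c l k x \<subseteq> cell c l j x"
  by (rule lift_Suc_antimono_le[of "\<lambda>k. cell c l k x"]) (simp_all only: cell_Suc_subset)

lemma cell_eventually_subset:
  fixes x :: "real^'n"
  assumes "0 < l" "open U" "x \<in> U"
  obtains k where "cell c l k x \<subseteq> U"
proof -
  obtain e where e: "0 < e" "ball x e \<subseteq> U"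
    using assms openE by blast
  \<comment> \<open>The factor \<open>CARD('n)\<close> comes from bounding the Euclidean norm by the
    sum of the coordinates, each of which differs by at most l / 2^k inside a cell.\<close>
  have "(\<lambda>k. of_nat CARD('n) * (l * (1 / 2) ^ k)) \<longlonglongrightarrow> of_nat CARD('n) * (l * 0)"
    by (intro tendsto_intros) auto
  then have "\<forall>\<^sub>F k in sequentially. of_nat CARD('n) * (l * (1 / 2) ^ k) < e"
    using e by (intro order_tendstoD(2)) auto
  then obtain k where k: "of_nat CARD('n) * (l * (1 / 2) ^ k) < e"
    by (auto simp: eventually_sequentially)
  have "cell c l k x \<subseteq> ball x e"
  proof
    fix y assume "y \<in> cell c l k x"
    moreover have "x \<in> cell c l k x" by simp
    ultimately have "\<bar>x $ i - y $ i\<bar> \<le> l / 2 ^ k" for i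
      unfolding cell_eq_cube[OF assms(1)] cube_def mem_Collect_eq by (smt (verit))
    then have "\<bar>(x - y) $ i\<bar> \<le> l * (1 / 2) ^ k" for i
      by (simp only: vector_minus_component power_one_over times_divide_eq_right mult_1_right)
    then have "(\<Sum>i\<in>UNIV. \<bar>(x - y) $ i\<bar>) \<le> of_nat CARD('n) * (l * (1 / 2) ^ k)"
      using sum_bounded_above[of UNIV "\<lambda>i. \<bar>(x - y) $ i\<bar>" "l * (1 / 2) ^ k"] by simp
    then show "y \<in> ball x e"
      using norm_le_l1_cart[of "x - y"] k by (simp add: dist_norm)
  qed
  with e that show thesis by blast
qed

text \<open>A cell is determined by its level and an integer vector of floor values.\<close>

lemma countable_cells:
  fixes c :: "real^'n"
  shows "countable {cell c l k x |k x. True}"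
proof -
  have "{cell c l k x |k x. True} \<subseteq>
      (\<lambda>(k, z). {y. \<forall>i. \<lfloor>2 ^ k * (y $ i - c $ i) / l\<rfloor> = z i}) ` (UNIV :: (nat \<times> ('n \<Rightarrow> int)) set)"
    by (force simp: cell_def image_iff)
  then show ?thesis
    by (rule countable_subset) simp
qed

text \<open>The stopping rule of the Calderon--Zygmund decomposition: along the decreasing cells
  around a point, take the first one with property \<open>P\<close>. The witness \<open>x\<close>
  does not matter, since all points of a cell share the cells at the lower levels.\<close>

definition maximal_cells :: "real^'n \<Rightarrow> real \<Rightarrow> ((real^'n) set \<Rightarrow> bool) \<Rightarrow> (real^'n) set set" where
  "maximal_cells c l P = {cell c l k x |k x. x \<in> cube c l \<and> P (cell c l k x) \<and> (\<forall>j<k. \<not> P (cell c l j x))}"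

lemma maximal_cells_countable: "countable (maximal_cells c l P)"
  by (rule countable_subset[OF _ countable_cells[of c l]]) (auto simp: maximal_cells_def)

lemma maximal_cells_subset:
  assumes "0 < l" "R \<in> maximal_cells c l P"
  shows "R \<in> cubes" "R \<subseteq> cube c l" "P R"
proof -
  obtain k x where kx: "x \<in> cube c l" "P R" "R = cell c l k x"
    using assms(2) by (auto simp: maximal_cells_def)
  then show "R \<in> cubes" "P R"
    using assms(1) by (auto intro: cell_in_cubes)
  show "R \<subseteq> cube c l"
    using kx cell_antimono[OF assms(1), of 0 k c x] cell_0[OF assms(1)] by auto
qed

text \<open>If two selected cells share a point \<open>y\<close>, then up to their own levels both
  have the same ancestors as \<open>y\<close>. The first level at which \<open>P\<close> holds along
  this single chain is unique, so the cells coincide.\<close>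

lemma maximal_cells_disjoint:
  assumes "0 < l"
  shows "pairwise disjnt (maximal_cells c l P)"
proof (rule pairwiseI)
  fix R R' assume R: "R \<in> maximal_cells c l P" "R' \<in> maximal_cells c l P" "R \<noteq> R'"
  obtain k x where kx: "P (cell c l k x)" "\<forall>j<k. \<not> P (cell c l j x)" "R = cell c l k x"
    using R(1) by (auto simp: maximal_cells_def)
  obtain k' x' where kx': "P (cell c l k' x')" "\<forall>j<k'. \<not> P (cell c l j x')" "R' = cell c l k' x'"
    using R(2) by (auto simp: maximal_cells_def)
  show "disjnt R R'"
  proof (rule ccontr)
    assume "\<not> disjnt R R'"
    then obtain y where y: "y \<in> cell c l k x" "y \<in> cell c l k' x'"
      using kx kx' by (auto simp: disjnt_def)
    have *: "cell c l j x = cell c l j y" if "j \<le> k" for j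
      using cell_eq cell_antimono[OF assms that] y(1) by blast
    have **: "cell c l j x' = cell c l j y" if "j \<le> k'" for j
      using cell_eq cell_antimono[OF assms that] y(2) by blast
    have "\<not> k < k'" "\<not> k' < k"
      using * ** kx(1,2) kx'(1,2) by (metis order.refl less_imp_le)+
    then have "k = k'" by simp
    with * ** kx(3) kx'(3) R(3) show False by simp
  qed
qed

lemma maximal_cells_cover:
  assumes "x \<in> cube c l" "P (cell c l k x)"
  shows "x \<in> \<Union>(maximal_cells c l P)"
proof -
  define k' where "k' = (LEAST k. P (cell c l k x))"
  have "P (cell c l k' x)" "\<forall>j<k'. \<not> P (cell c l j x)"
    unfolding k'_def using LeastI[of "\<lambda>k. P (cell c l k x)", OF assms(2)] not_less_Least by auto
  then have "cell c l k' x \<in> maximal_cells c l P"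
    using assms(1) by (auto simp: maximal_cells_def)
  then show ?thesis
    using mem_cell by blast
qed

text \<open>The cell one level up was rejected by minimality of the level and has 2^n times the
  volume. It exists inside the cube because level 0 is the cube itself, which fails
  \<open>P\<close>.\<close>

lemma maximal_cells_parent:
  fixes c :: "real^'n"
  assumes "0 < l" "R \<in> maximal_cells c l P" "\<not> P (cube c l)"
  obtains R' where "R' \<in> cubes" "R \<subseteq> R'" "R' \<subseteq> cube c l" "\<not> P R'"
    "measure lebesgue R' = 2 ^ CARD('n) * measure lebesgue R"
proof -
  obtain k x where kx: "x \<in> cube c l" "P R" "R = cell c l k x" "\<forall>j<k. \<not> P (cell c l j x)"
    using assms(2) unfolding maximal_cells_def by blast
  have "k \<noteq> 0"
    using kx assms(1,3) cell_0[OF assms(1) kx(1)] by (intro notI) simp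
  then obtain j where j: "k = Suc j" by (cases k) auto
  show thesis
  proof
    show "cell c l j x \<in> cubes" by (simp add: assms cell_in_cubes)
    show "R \<subseteq> cell c l j x" using kx j assms cell_Suc_subset by blast
    show "cell c l j x \<subseteq> cube c l"
      using cell_antimono[OF assms(1), of 0 j c x] cell_0[OF assms(1) kx(1)] by auto
    show "\<not> P (cell c l j x)" using kx j by auto
    show "measure lebesgue (cell c l j x) = 2 ^ CARD('n) * measure lebesgue R"
      unfolding kx(3) j measure_cell[OF assms(1)] power_mult_distrib[symmetric] by simp
  qed
qed

section \<open>Polynomials and their orthogonal projections\<close>

lemma finite_exponents: "finite {\<alpha> :: 'n::finite \<Rightarrow> nat. (\<Sum>i\<in>UNIV. \<alpha> i) \<le> m}"
proof (rule finite_subset)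
  \<comment> \<open>No exponent exceeds the total degree. Finiteness matters because a sum over an
    infinite index set would be 0 by default.\<close>
  have "\<alpha> i \<le> (\<Sum>i\<in>UNIV. \<alpha> i)" for \<alpha> :: "'n \<Rightarrow> nat" and i
    by (rule member_le_sum) auto
  then  show "{\<alpha> :: 'n \<Rightarrow> nat. (\<Sum>i\<in>UNIV. \<alpha> i) \<le> m} \<subseteq> {\<alpha>. \<forall>i. (i \<in> UNIV \<longrightarrow> \<alpha> i \<in> {..m}) \<and> (i \<notin> UNIV \<longrightarrow> \<alpha> i = 0)}"
    by (auto intro: order_trans)
qed (rule finite_set_of_finite_funs; simp)

lemma poly_space_monomial:
  assumes "(\<Sum>i\<in>UNIV. \<alpha> i) \<le> m"
  shows "(\<lambda>x :: real^'n. \<Prod>i\<in>UNIV. x $ i ^ \<alpha> i) \<in> poly_space m"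
proof -
  have "(\<Prod>i\<in>UNIV. x $ i ^ \<alpha> i) =
      (\<Sum>\<beta> | (\<Sum>i\<in>UNIV. \<beta> i) \<le> m. (if \<beta> = \<alpha> then 1 else 0) * (\<Prod>i\<in>UNIV. x $ i ^ \<beta> i))" for x :: "real^'n"
    using assms by (simp add: sum.delta finite_exponents if_distrib[of "\<lambda>t. t * _"] cong: if_cong)
  then have "(\<lambda>x :: real^'n. \<Prod>i\<in>UNIV. x $ i ^ \<alpha> i) =
      (\<lambda>x. \<Sum>\<beta> | (\<Sum>i\<in>UNIV. \<beta> i) \<le> m. (if \<beta> = \<alpha> then 1 else 0) * (\<Prod>i\<in>UNIV. x $ i ^ \<beta> i))"
    by (rule ext)
  then show ?thesis
    unfolding poly_space_def by (intro CollectI exI)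
qed

lemma poly_space_add:
  assumes "f \<in> poly_space m" "g \<in> poly_space m"
  shows "(\<lambda>x. f x + g x) \<in> poly_space m"
proof -
  obtain c d where "f = (\<lambda>x. \<Sum>\<alpha> | (\<Sum>i\<in>UNIV. \<alpha> i) \<le> m. c \<alpha> * (\<Prod>i\<in>UNIV. x $ i ^ \<alpha> i))"
    "g = (\<lambda>x. \<Sum>\<alpha> | (\<Sum>i\<in>UNIV. \<alpha> i) \<le> m. d \<alpha> * (\<Prod>i\<in>UNIV. x $ i ^ \<alpha> i))"
    using assms by (auto simp: poly_space_def)
  then have "(\<lambda>x. f x + g x) = (\<lambda>x. \<Sum>\<alpha> | (\<Sum>i\<in>UNIV. \<alpha> i) \<le> m. (c \<alpha> + d \<alpha>) * (\<Prod>i\<in>UNIV. x $ i ^ \<alpha> i))"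
    by (simp add: sum.distrib distrib_right)
  then show ?thesis
    unfolding poly_space_def by (intro CollectI exI)
qed

lemma poly_space_cmult:
  assumes "f \<in> poly_space m"
  shows "(\<lambda>x. r * f x) \<in> poly_space m"
proof -
  obtain c where "f = (\<lambda>x. \<Sum>\<alpha> | (\<Sum>i\<in>UNIV. \<alpha> i) \<le> m. c \<alpha> * (\<Prod>i\<in>UNIV. x $ i ^ \<alpha> i))"
    using assms by (auto simp: poly_space_def)
  then have "(\<lambda>x. r * f x) = (\<lambda>x. \<Sum>\<alpha> | (\<Sum>i\<in>UNIV. \<alpha> i) \<le> m. (r * c \<alpha>) * (\<Prod>i\<in>UNIV. x $ i ^ \<alpha> i))"
    by (simp add: sum_distrib_left mult.assoc)
  then show ?thesis
    unfolding poly_space_def by (intro CollectI exI)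
qed

lemma poly_space_const: "(\<lambda>x. r) \<in> poly_space m"
  using poly_space_cmult[OF poly_space_monomial[of "\<lambda>_. 0" m], of r] by simp

lemma poly_space_diff:
  assumes "f \<in> poly_space m" "g \<in> poly_space m"
  shows "(\<lambda>x. f x - g x) \<in> poly_space m"
  using poly_space_add[OF assms(1) poly_space_cmult[OF assms(2), of "-1"]] by simp

lemma poly_space_sum:
  "(\<And>i. i \<in> I \<Longrightarrow> f i \<in> poly_space m) \<Longrightarrow> (\<lambda>x. \<Sum>i\<in>I. f i x) \<in> poly_space m"
  by (induction I rule: infinite_finite_induct) (auto intro: poly_space_const poly_space_add)

lemma poly_space_mult:
  assumes "f \<in> poly_space k" "g \<in> poly_space l"
  shows "(\<lambda>x. f x * g x) \<in> poly_space (k + l)"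
proof -
  obtain c d where cd: "f = (\<lambda>x. \<Sum>\<alpha> | (\<Sum>i\<in>UNIV. \<alpha> i) \<le> k. c \<alpha> * (\<Prod>i\<in>UNIV. x $ i ^ \<alpha> i))"
    "g = (\<lambda>x. \<Sum>\<alpha> | (\<Sum>i\<in>UNIV. \<alpha> i) \<le> l. d \<alpha> * (\<Prod>i\<in>UNIV. x $ i ^ \<alpha> i))"
    using assms by (auto simp: poly_space_def)
  have eq: "(\<lambda>x. f x * g x) = (\<lambda>x. \<Sum>\<alpha> | (\<Sum>i\<in>UNIV. \<alpha> i) \<le> k. \<Sum>\<beta> | (\<Sum>i\<in>UNIV. \<beta> i) \<le> l.
      (c \<alpha> * d \<beta>) * (\<Prod>i\<in>UNIV. x $ i ^ (\<alpha> i + \<beta> i)))"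
    by (simp add: cd sum_product power_add prod.distrib mult_ac)
  show ?thesis
    unfolding eq
    by (intro poly_space_sum poly_space_cmult poly_space_monomial) (simp add: sum.distrib)
qed

lemma poly_space_affine_coord: "(\<lambda>x :: real^'n. b + r * x $ i) \<in> poly_space 1"
proof -
  have "(\<lambda>x :: real^'n. \<Prod>j\<in>UNIV. x $ j ^ (if j = i then 1 else 0)) \<in> poly_space 1"
    by (intro poly_space_monomial) simp
  also have "(\<lambda>x :: real^'n. \<Prod>j\<in>UNIV. x $ j ^ (if j = i then 1 else 0)) = (\<lambda>x. x $ i)"
    by (simp add: if_distrib[of "\<lambda>t. _ ^ t"] prod.delta cong: if_cong)
  finally show ?thesis
    by (intro poly_space_add poly_space_const poly_space_cmult)
qed

lemma poly_space_power: "f \<in> poly_space 1 \<Longrightarrow> (\<lambda>x. f x ^ k) \<in> poly_space k"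
proof (induction k)
  case (Suc k)
  then show ?case using poly_space_mult[of f 1 "\<lambda>x. f x ^ k" k] by simp
qed (simp add: poly_space_const)

lemma poly_space_prod:
  assumes "finite I" "\<And>i. i \<in> I \<Longrightarrow> f i \<in> poly_space (k i)"
  shows "(\<lambda>x. \<Prod>i\<in>I. f i x) \<in> poly_space (\<Sum>i\<in>I. k i)"
  using assms
proof (induction I)
  case (insert i I)
  then show ?case using poly_space_mult[of "f i" "k i" "\<lambda>x. \<Prod>i\<in>I. f i x"] by simp
qed (simp add: poly_space_const)

lemma poly_space_mono:
  assumes "k \<le> m" "f \<in> poly_space k"
  shows "f \<in> poly_space m"
  using poly_space_mult[OF assms(2) poly_space_const[of 1 "m - k"]] assms(1) by simp

text \<open>Lets estimates on the unit cube be carried over to every cube by translation and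
  dilation.\<close>

lemma poly_space_affine:
  fixes b :: "real^'n"
  assumes "g \<in> poly_space m"
  shows "(\<lambda>x. g (b + r *\<^sub>R x)) \<in> poly_space m"
proof -
  obtain c where c: "g = (\<lambda>x. \<Sum>\<alpha> | (\<Sum>i\<in>UNIV. \<alpha> i) \<le> m. c \<alpha> * (\<Prod>i\<in>UNIV. x $ i ^ \<alpha> i))"
    using assms by (auto simp: poly_space_def)
  have "(\<lambda>x. \<Prod>i\<in>UNIV. (b $ i + r * x $ i) ^ \<alpha> i) \<in> poly_space m" if "(\<Sum>i\<in>UNIV. \<alpha> i) \<le> m" for \<alpha>
    by (rule poly_space_mono[OF that], intro poly_space_prod poly_space_power poly_space_affine_coord) simp
  then show ?thesis
    by (simp add: c) (intro poly_space_sum poly_space_cmult, simp)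
qed

lemma poly_space_polynomial:
  fixes g :: "real^'n \<Rightarrow> real"
  assumes "g \<in> poly_space m"
  shows "real_polynomial_function g"
proof -
  obtain c where c: "g = (\<lambda>x. \<Sum>\<alpha> | (\<Sum>i\<in>UNIV. \<alpha> i) \<le> m. c \<alpha> * (\<Prod>i\<in>UNIV. x $ i ^ \<alpha> i))"
    using assms by (auto simp: poly_space_def)
  have "real_polynomial_function (\<lambda>x :: real^'n. x $ i)" for i
    by (intro real_polynomial_function.intros(1) bounded_linear_vec_nth)
  then show ?thesis
    unfolding c
    by (intro real_polynomial_function_sum real_polynomial_function.intros(2,4)
        real_polynomial_function_prod real_polynomial_function_power finite_exponents) auto
qed

lemma poly_space_continuous: "g \<in> poly_space m \<Longrightarrow> continuous_on S g"
  by (simp add: poly_space_polynomial continuous_on_polymonial_function flip: real_polynomial_function_eq)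

lemma poly_space_borel: "g \<in> poly_space m \<Longrightarrow> g \<in> borel_measurable borel"
  using poly_space_continuous by (intro borel_measurable_continuous_onI)

lemma poly_space_lebesgue: "g \<in> poly_space m \<Longrightarrow> g \<in> borel_measurable lebesgue"
  using poly_space_borel by (intro measurable_completion) simp

text \<open>Along the line from \<open>z\<close> to \<open>x\<close> the function is a polynomial in
  one variable that vanishes on an open, hence infinite, set of parameters. All its coefficients are
  therefore 0, and the parameter 1 gives the value at \<open>x\<close>.\<close>

lemma real_polynomial_zero_on_open:
  fixes g :: "'a::euclidean_space \<Rightarrow> real"
  assumes g: "real_polynomial_function g" and U: "open U" "z \<in> U" and 0: "\<And>x. x \<in> U \<Longrightarrow> g x = 0"
  shows "g x = 0"
proof -
  have "real_polynomial_function (g \<circ> (\<lambda>t :: real. z + t *\<^sub>R (x - z)))"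
    using g by (intro real_polynomial_function_compose)
      (intro polynomial_function_add polynomial_function_const polynomial_function_mult
        polynomial_function_bounded_linear bounded_linear_ident)
  then obtain a n where an: "g \<circ> (\<lambda>t. z + t *\<^sub>R (x - z)) = (\<lambda>t. \<Sum>i\<le>n. a i * t ^ i)"
    unfolding real_polynomial_function_iff_sum by blast
  have "open ((\<lambda>t :: real. z + t *\<^sub>R (x - z)) -` U)"
    by (intro open_vimage U continuous_intros)
  moreover have "0 \<in> (\<lambda>t :: real. z + t *\<^sub>R (x - z)) -` U"
    using U by simp
  ultimately have "infinite ((\<lambda>t :: real. z + t *\<^sub>R (x - z)) -` U)"
    using finite_imp_not_open by (metis empty_iff)
  moreover have "(\<lambda>t :: real. z + t *\<^sub>R (x - z)) -` U \<subseteq> {t. (\<Sum>i\<le>n. a i * t ^ i) = 0}"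
  proof safe
    fix t assume "z + t *\<^sub>R (x - z) \<in> U"
    from 0[OF this] show "(\<Sum>i\<le>n. a i * t ^ i) = 0"
      using fun_cong[OF an, of t] by simp
  qed
  ultimately have "\<forall>i\<le>n. a i = 0"
    using polyfun_finite_roots[of a n] finite_subset by blast
  then show ?thesis
    using fun_cong[OF an, of 1] by simp
qed

section \<open>Integrability on cubes and the inner product\<close>

lemma set_integrable_continuous_cube:
  fixes g :: "real^'n \<Rightarrow> real"
  assumes "continuous_on UNIV g" "Q \<in> cubes"
  shows "set_integrable lebesgue Q g"
proof -
  obtain c l where "0 < l" "Q = cube c l"
    using assms(2) by (rule cubesE)
  have "set_integrable lborel (cbox c (c + (\<chi> i. l))) g"
    unfolding set_integrable_def by (rule borel_integrable_compact[OF compact_cbox continuous_on_subset[OF assms(1) subset_UNIV]])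
  then have "set_integrable lebesgue (cbox c (c + (\<chi> i. l))) g"
    unfolding set_integrable_def
    by (subst integrable_completion) (erule borel_measurable_integrable)
  then show ?thesis
    by (rule set_integrable_subset) (use \<open>Q = _\<close> assms(2) cubes_lebesgue cube_subset_cbox in auto)
qed

lemma average_add:
  assumes "set_integrable lebesgue Q f" "set_integrable lebesgue Q g"
  shows "average Q (\<lambda>x. f x + g x) = average Q f + average Q g"
  using assms by (simp add: average_def add_divide_distrib)

lemma average_diff:
  assumes "set_integrable lebesgue Q f" "set_integrable lebesgue Q g"
  shows "average Q (\<lambda>x. f x - g x) = average Q f - average Q g"
  using assms by (simp add: average_def diff_divide_distrib)

lemma average_cmult: "average Q (\<lambda>x. r * f x) = r * average Q f"
  by (simp add: average_def)

lemma average_sum: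
  assumes "finite I" "\<And>i. i \<in> I \<Longrightarrow> set_integrable lebesgue Q (f i)"
  shows "average Q (\<lambda>x. \<Sum>i\<in>I. f i x) = (\<Sum>i\<in>I. average Q (f i))"
  using assms
proof (induction I)
  case (insert i I)
  then have "set_integrable lebesgue Q (\<lambda>x. \<Sum>i\<in>I. f i x)"
    unfolding set_integrable_def scaleR_sum_right by (intro Bochner_Integration.integrable_sum) simp
  with insert show ?case
    by (simp add: average_add)
qed (simp add: average_def set_lebesgue_integral_def)

text \<open>A polynomial is bounded on the closed box containing the cube, so the product is
  dominated by a multiple of \<open>f\<close>.\<close>

lemma set_integrable_mult_poly:
  fixes f g :: "real^'n \<Rightarrow> real"
  assumes f: "set_integrable lebesgue Q f" and g: "g \<in> poly_space m" and Q: "Q \<in> cubes"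
  shows "set_integrable lebesgue Q (\<lambda>x. f x * g x)"
proof -
  obtain c l where cl: "0 < l" "Q = cube c l"
    using Q by (rule cubesE)
  have "bounded (g ` cbox c (c + (\<chi> i. l)))"
    by (intro compact_imp_bounded compact_continuous_image poly_space_continuous[OF g] compact_cbox)
  then obtain K where K: "\<And>x. x \<in> Q \<Longrightarrow> \<bar>g x\<bar> \<le> K"
    using cl cube_subset_cbox unfolding bounded_iff by (metis imageI real_norm_def subsetD)
  have "integrable lebesgue (\<lambda>x. (indicator Q x *\<^sub>R f x) * g x)"
  proof (rule Bochner_Integration.integrable_bound)
    show "integrable lebesgue (\<lambda>x. K * (indicator Q x *\<^sub>R f x))"
      using f by (auto simp: set_integrable_def)
    show "(\<lambda>x. (indicator Q x *\<^sub>R f x) * g x) \<in> borel_measurable lebesgue"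
      using f poly_space_lebesgue[OF g] unfolding set_integrable_def by (intro borel_measurable_times) auto
    show "AE x in lebesgue. norm (indicator Q x *\<^sub>R f x * g x) \<le> norm (K * indicator Q x *\<^sub>R f x)"
    proof (intro AE_I2)
      fix x
      show "norm (indicator Q x *\<^sub>R f x * g x) \<le> norm (K * indicator Q x *\<^sub>R f x)"
      proof (cases "x \<in> Q")
        case True
        then have "\<bar>f x\<bar> * \<bar>g x\<bar> \<le> \<bar>f x\<bar> * \<bar>K\<bar>"
          using K[OF True] by (intro mult_left_mono) auto
        then show ?thesis
          using True by (simp add: abs_mult mult.commute)
      qed simp
    qed
  qed
  then show ?thesis
    by (simp add: set_integrable_def mult.assoc)
qed

lemma poly_space_integrable:
  "g \<in> poly_space m \<Longrightarrow> Q \<in> cubes \<Longrightarrow> set_integrable lebesgue Q g"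
  by (intro set_integrable_continuous_cube poly_space_continuous)

lemma poly_mult_integrable:
  "f \<in> poly_space m \<Longrightarrow> g \<in> poly_space m \<Longrightarrow> Q \<in> cubes \<Longrightarrow> set_integrable lebesgue Q (\<lambda>x. f x * g x)"
  by (intro set_integrable_mult_poly poly_space_integrable)

lemma average_sq_nonneg: "0 \<le> average Q (\<lambda>x. g x * g x)"
  by (auto simp: average_def set_lebesgue_integral_def intro!: divide_nonneg_nonneg Bochner_Integration.integral_nonneg)

text \<open>Definiteness of the inner product. The points of the open box with nonzero value form a
  set that is open and negligible, hence empty; a polynomial that vanishes on a box vanishes
  everywhere.\<close>

lemma poly_average_sq_eq_0:
  fixes h :: "real^'n \<Rightarrow> real"
  assumes h: "h \<in> poly_space m" and Q: "Q \<in> cubes" and 0: "average Q (\<lambda>x. h x * h x) = 0"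
  shows "h y = 0"
proof -
  obtain c l where cl: "0 < l" "Q = cube c l"
    using Q by (rule cubesE)
  let ?B = "box c (c + (\<chi> i. l))"
  have "(LINT x|lebesgue. indicator Q x *\<^sub>R (h x * h x)) = 0"
    using 0 cubes_measure_pos[OF Q] by (simp add: average_def set_lebesgue_integral_def)
  then have "AE x in lebesgue. indicator Q x *\<^sub>R (h x * h x) = 0"
    using poly_mult_integrable[OF h h Q]
    by (subst (asm) integral_nonneg_eq_0_iff_AE) (auto simp: set_integrable_def)
  then have AE: "AE x in lebesgue. x \<notin> {x \<in> ?B. h x \<noteq> 0}"
    by eventually_elim (use box_subset_cube cl in \<open>auto simp: indicator_def\<close>)
  have "open {x \<in> ?B. h x \<noteq> 0}"
  proof -
    have "open (?B \<inter> h -` (- {0}))"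
      by (intro continuous_open_preimage poly_space_continuous[OF h] open_box open_Compl closed_singleton)
    also have "?B \<inter> h -` (- {0}) = {x \<in> ?B. h x \<noteq> 0}" by blast
    finally show ?thesis .
  qed
  moreover have "negligible {x \<in> ?B. h x \<noteq> 0}"
  proof -
    have "{x \<in> ?B. h x \<noteq> 0} \<in> sets lebesgue"
      using borel_open[OF calculation] by (intro sets_completionI_sets) simp
    then show ?thesis
      unfolding negligible_iff_null_sets using AE by (simp only: AE_iff_null_sets)
  qed
  ultimately have "{x \<in> ?B. h x \<noteq> 0} = {}"
    using open_not_negligible by blast
  then have "\<And>x. x \<in> ?B \<Longrightarrow> h x = 0" by blast
  moreover have "c + (\<chi> i. l / 2) \<in> ?B"
    using cl by (simp add: mem_box_cart)
  ultimately show ?thesis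
    using real_polynomial_zero_on_open[OF poly_space_polynomial[OF h] open_box] by blast
qed

section \<open>Orthonormal bases\<close>

lemma average_sum_mult:
  assumes "finite B" "B \<subseteq> poly_space m" "g \<in> poly_space m" "Q \<in> cubes"
  shows "average Q (\<lambda>x. (\<Sum>\<phi>\<in>B. c \<phi> * \<phi> x) * g x) = (\<Sum>\<phi>\<in>B. c \<phi> * average Q (\<lambda>x. \<phi> x * g x))"
proof -
  have "average Q (\<lambda>x. \<Sum>\<phi>\<in>B. c \<phi> * (\<phi> x * g x)) = (\<Sum>\<phi>\<in>B. average Q (\<lambda>x. c \<phi> * (\<phi> x * g x)))"
    using assms by (intro average_sum set_integrable_mult_right) (auto intro: poly_mult_integrable)
  then show ?thesis
    by (simp add: sum_distrib_right mult.assoc average_cmult)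
qed

text \<open>Induction over \<open>M\<close>: subtract from the new element \<open>g\<close> its
  component \<open>s\<close> in the span of \<open>B\<close>. If the remainder \<open>h\<close> has
  norm 0, then \<open>B\<close> already represents \<open>g\<close>; otherwise the normalised
  remainder is added to \<open>B\<close>.\<close>

lemma gram_schmidt:
  assumes Q: "Q \<in> cubes" and "finite M" "M \<subseteq> poly_space m"
  shows "\<exists>B. finite B \<and> B \<subseteq> poly_space m \<and>
     (\<forall>\<phi>\<in>B. \<forall>\<psi>\<in>B. average Q (\<lambda>x. \<phi> x * \<psi> x) = (if \<phi> = \<psi> then 1 else 0)) \<and>
     (\<forall>g\<in>M. \<exists>c. \<forall>x. g x = (\<Sum>\<phi>\<in>B. c \<phi> * \<phi> x))"
  using assms(2,3)
proof (induction M)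
  case empty
  then show ?case by (intro exI[of _ "{}"]) simp
next
  case (insert g M)
  have "M \<subseteq> poly_space m" using insert.prems by simp
  from insert.IH[OF this] obtain B where B: "finite B" "B \<subseteq> poly_space m"
    "\<forall>\<phi>\<in>B. \<forall>\<psi>\<in>B. average Q (\<lambda>x. \<phi> x * \<psi> x) = (if \<phi> = \<psi> then 1 else 0)"
    and M: "\<forall>g\<in>M. \<exists>c. \<forall>x. g x = (\<Sum>\<phi>\<in>B. c \<phi> * \<phi> x)" by (elim exE conjE)
  have g: "g \<in> poly_space m" using insert by simp
  define d where "d \<phi> = average Q (\<lambda>x. g x * \<phi> x)" for \<phi>
  define s where "s = (\<lambda>x. \<Sum>\<phi>\<in>B. d \<phi> * \<phi> x)"
  define h where "h = (\<lambda>x. g x - s x)"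
  have s: "s \<in> poly_space m"
    unfolding s_def using B by (intro poly_space_sum poly_space_cmult) auto
  have h: "h \<in> poly_space m"
    unfolding h_def by (intro poly_space_diff g s)
  have orth: "average Q (\<lambda>x. h x * \<phi> x) = 0" if "\<phi> \<in> B" for \<phi>
  proof -
    have \<phi>: "\<phi> \<in> poly_space m" using that B by auto
    have "average Q (\<lambda>x. s x * \<phi> x) = (\<Sum>\<psi>\<in>B. d \<psi> * (if \<psi> = \<phi> then 1 else 0))"
      unfolding s_def using B that by (subst average_sum_mult[OF B(1,2) \<phi> Q]) (simp add: B(3)[rule_format] cong: sum.cong)
    also have "\<dots> = d \<phi>"
      using B that by (simp add: sum.delta if_distrib[of "\<lambda>t. _ * t"] cong: if_cong)
    finally show ?thesis
      unfolding h_def left_diff_distrib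
      by (subst average_diff) (auto intro!: poly_mult_integrable g s \<phi> Q simp: d_def)
  qed
  show ?case
  proof (cases "average Q (\<lambda>x. h x * h x) = 0")
    case True
    then have "\<forall>x. g x = (\<Sum>\<phi>\<in>B. d \<phi> * \<phi> x)"
      using poly_average_sq_eq_0[OF h Q] by (auto simp: h_def s_def)
    then have "\<forall>f\<in>insert g M. \<exists>c. \<forall>x. f x = (\<Sum>\<phi>\<in>B. c \<phi> * \<phi> x)"
      using M by blast
    with B show ?thesis
      by (intro exI[of _ B] conjI)
  next
    case False
    define r where "r = sqrt (average Q (\<lambda>x. h x * h x))"
    define \<eta> where "\<eta> = (\<lambda>x. 1 / r * h x)"
    have r: "0 < r" "r * r = average Q (\<lambda>x. h x * h x)"
      using False average_sq_nonneg[of Q h] by (auto simp: r_def)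
    have \<eta>: "\<eta> \<in> poly_space m"
      unfolding \<eta>_def by (intro poly_space_cmult h)
    have "average Q (\<lambda>x. \<eta> x * \<eta> x) = average Q (\<lambda>x. (1 / (r * r)) * (h x * h x))"
      by (simp add: \<eta>_def)
    also have "\<dots> = 1"
      unfolding average_cmult using r by (simp flip: r(2))
    finally have \<eta>1: "average Q (\<lambda>x. \<eta> x * \<eta> x) = 1" .
    have \<eta>0: "average Q (\<lambda>x. \<eta> x * \<phi> x) = 0" if "\<phi> \<in> B" for \<phi>
      unfolding \<eta>_def mult.assoc average_cmult using orth[OF that] by simp
    then have \<eta>0': "average Q (\<lambda>x. \<phi> x * \<eta> x) = 0" if "\<phi> \<in> B" for \<phi>
    proof -
      have "(\<lambda>x. \<phi> x * \<eta> x) = (\<lambda>x. \<eta> x * \<phi> x)"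
        by (simp add: fun_eq_iff mult.commute)
      then show ?thesis
        by (simp only: \<eta>0[OF that])
    qed
    \<comment> \<open>An element of \<open>B\<close> would be orthogonal to itself here,
      contradicting norm 1. That \<open>\<eta>\<close> is new allows its coefficient to be set
      without disturbing the sum over \<open>B\<close>.\<close>
    have "\<eta> \<notin> B" using \<eta>1 \<eta>0[of \<eta>] by auto
    have "\<exists>c. \<forall>x. f x = (\<Sum>\<phi>\<in>insert \<eta> B. c \<phi> * \<phi> x)" if "f \<in> insert g M" for f
    proof -
      have "\<exists>c t. \<forall>x. f x = t * \<eta> x + (\<Sum>\<phi>\<in>B. c \<phi> * \<phi> x)"
      proof (cases "f = g")
        case True
        have "g x = r * \<eta> x + (\<Sum>\<phi>\<in>B. d \<phi> * \<phi> x)" for x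
          using r by (simp add: \<eta>_def h_def s_def)
        with True show ?thesis by blast
      next
        case False
        with that have "f \<in> M" by simp
        with M obtain c where "\<forall>x. f x = (\<Sum>\<phi>\<in>B. c \<phi> * \<phi> x)" by blast
        then have "\<forall>x. f x = 0 * \<eta> x + (\<Sum>\<phi>\<in>B. c \<phi> * \<phi> x)" by simp
        then show ?thesis by blast
      qed
      then obtain c t where ct: "\<And>x. f x = t * \<eta> x + (\<Sum>\<phi>\<in>B. c \<phi> * \<phi> x)" by blast
      have "(\<Sum>\<phi>\<in>B. (c(\<eta> := t)) \<phi> * \<phi> x) = (\<Sum>\<phi>\<in>B. c \<phi> * \<phi> x)" for x
        using \<open>\<eta> \<notin> B\<close> by (intro sum.cong) auto
      then have "\<forall>x. f x = (\<Sum>\<phi>\<in>insert \<eta> B. (c(\<eta> := t)) \<phi> * \<phi> x)"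
        using ct B(1) \<open>\<eta> \<notin> B\<close> by simp
      then show ?thesis by blast
    qed
    moreover have "average Q (\<lambda>x. \<phi> x * \<psi> x) = (if \<phi> = \<psi> then 1 else 0)"
      if "\<phi> \<in> insert \<eta> B" "\<psi> \<in> insert \<eta> B" for \<phi> \<psi>
      using that \<eta>1 \<eta>0 \<eta>0' B(3)[rule_format, of \<phi> \<psi>] \<open>\<eta> \<notin> B\<close> by auto
    ultimately show ?thesis
      using B(1,2) \<eta> by (intro exI[of _ "insert \<eta> B"] conjI ballI) simp_all
  qed
qed

text \<open>Gram--Schmidt applied to the monomials, which span the space. This is what gives the
  choice in \<open>poly_proj\<close> a genuine basis.\<close>

lemma orthonormal_basis_exists:
  fixes Q :: "(real^'n) set"
  assumes Q: "Q \<in> cubes"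
  shows "\<exists>B. orthonormal_basis m Q B"
proof -
  let ?E = "{\<alpha> :: 'n \<Rightarrow> nat. (\<Sum>i\<in>UNIV. \<alpha> i) \<le> m}"
  let ?mono = "\<lambda>\<alpha> (x :: real^'n). \<Prod>i\<in>UNIV. x $ i ^ \<alpha> i"
  have "?mono ` ?E \<subseteq> poly_space m"
    using poly_space_monomial by blast
  from gram_schmidt[OF Q finite_imageI[OF finite_exponents] this]
  obtain B where B: "finite B" "B \<subseteq> poly_space m"
    "\<forall>\<phi>\<in>B. \<forall>\<psi>\<in>B. average Q (\<lambda>x. \<phi> x * \<psi> x) = (if \<phi> = \<psi> then 1 else 0)"
    "\<forall>g\<in>?mono ` ?E. \<exists>c. \<forall>x. g x = (\<Sum>\<phi>\<in>B. c \<phi> * \<phi> x)"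
    by (elim exE conjE)
  from B(4) have "\<forall>\<alpha>\<in>?E. \<exists>c. \<forall>x. ?mono \<alpha> x = (\<Sum>\<phi>\<in>B. c \<phi> * \<phi> x)"
    by (simp only: ball_simps)
  from bchoice[OF this] obtain C where C: "\<And>\<alpha> x. \<alpha> \<in> ?E \<Longrightarrow> ?mono \<alpha> x = (\<Sum>\<phi>\<in>B. C \<alpha> \<phi> * \<phi> x)"
    by blast
  have "\<exists>c. \<forall>x. g x = (\<Sum>\<phi>\<in>B. c \<phi> * \<phi> x)" if g: "g \<in> poly_space m" for g
  proof -
    obtain a where a: "g = (\<lambda>x. \<Sum>\<alpha>\<in>?E. a \<alpha> * ?mono \<alpha> x)"
      using g unfolding poly_space_def by blast
    have "g x = (\<Sum>\<alpha>\<in>?E. a \<alpha> * (\<Sum>\<phi>\<in>B. C \<alpha> \<phi> * \<phi> x))" for x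
      unfolding a using C by (intro sum.cong refl) simp
    also have "\<dots> x = (\<Sum>\<phi>\<in>B. (\<Sum>\<alpha>\<in>?E. a \<alpha> * C \<alpha> \<phi>) * \<phi> x)" for x
      unfolding sum_distrib_left sum_distrib_right mult.assoc by (rule sum.swap)
    finally have "\<forall>x. g x = (\<Sum>\<phi>\<in>B. (\<Sum>\<alpha>\<in>?E. a \<alpha> * C \<alpha> \<phi>) * \<phi> x)" by blast
    then show ?thesis by (intro exI)
  qed
  then show ?thesis
    using B unfolding orthonormal_basis_def by blast
qed

section \<open>Bounds for polynomials that are uniform in the cube\<close>

lemma average_cube_affine:
  fixes c :: "real^'n"
  assumes "0 < l" "g \<in> borel_measurable borel"
  shows "average (cube c l) g = average (cube 0 1) (\<lambda>x. g (c + l *\<^sub>R x))"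
proof -
  \<comment> \<open>The substitution has Jacobian l^n, which later cancels against the volume of
    \<open>cube c l\<close>. Borel measurability of \<open>g\<close> permits the change of variables
    in \<open>lborel\<close>; completion then returns to \<open>lebesgue\<close>.\<close>
  have D: "lborel = density (distr lborel borel (\<lambda>x. c + l *\<^sub>R x)) (\<lambda>_. ennreal (l ^ CARD('n)))"
    using lborel_affine[of l c] assms(1) by (simp add: ennreal_power)
  have eq: "c + l *\<^sub>R x \<in> cube c l \<longleftrightarrow> x \<in> cube 0 1" for x
    using assms(1) by (auto simp: cube_def zero_le_mult_iff)
  have [measurable]: "g \<in> borel_measurable borel" by fact
  let ?D = "distr lborel borel (\<lambda>x. c + l *\<^sub>R x)"
  have "(LINT x:cube c l|lebesgue. g x) = (LINT x|lborel. indicator (cube c l) x *\<^sub>R g x)"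
    unfolding set_lebesgue_integral_def by (intro integral_completion) simp
  also have "\<dots> = (LINT x|density ?D (\<lambda>_. ennreal (l ^ CARD('n))). indicator (cube c l) x *\<^sub>R g x)"
    by (rule arg_cong[where f = "\<lambda>M. integral\<^sup>L M _", OF D])
  also have "\<dots> = (LINT x|?D. l ^ CARD('n) *\<^sub>R (indicator (cube c l) x *\<^sub>R g x))"
    using assms(1) by (intro integral_density) auto
  also have "\<dots> = (LINT x|lborel. l ^ CARD('n) *\<^sub>R (indicator (cube c l) (c + l *\<^sub>R x) *\<^sub>R g (c + l *\<^sub>R x)))"
    by (rule integral_distr) auto
  also have "\<dots> = l ^ CARD('n) * (LINT x:cube 0 1|lebesgue. g (c + l *\<^sub>R x))"
    unfolding set_lebesgue_integral_def
    by (subst integral_completion) (simp_all add: indicator_def eq)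
  finally show ?thesis
    using assms(1) measure_cube[of l c] measure_cube[of 1 "0 :: real^'n"] by (simp add: average_def del: measure_completion)
qed

lemma orthonormal_coefficient:
  assumes B: "orthonormal_basis m Q B" and Q: "Q \<in> cubes" and \<phi>: "\<phi> \<in> B"
  shows "average Q (\<lambda>x. (\<Sum>\<psi>\<in>B. c \<psi> * \<psi> x) * \<phi> x) = c \<phi>"
proof -
  have B': "finite B" "B \<subseteq> poly_space m" "\<And>\<psi>. \<psi> \<in> B \<Longrightarrow> average Q (\<lambda>x. \<psi> x * \<phi> x) = (if \<psi> = \<phi> then 1 else 0)"
    using B \<phi> unfolding orthonormal_basis_def by blast+
  have "average Q (\<lambda>x. (\<Sum>\<psi>\<in>B. c \<psi> * \<psi> x) * \<phi> x) = (\<Sum>\<psi>\<in>B. c \<psi> * (if \<psi> = \<phi> then 1 else 0))"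
    using B' \<phi> by (subst average_sum_mult[OF B'(1,2) _ Q]) (auto cong: sum.cong)
  also have "\<dots> = c \<phi>"
    using B' \<phi> by (simp add: sum.delta if_distrib[of "\<lambda>t. _ * t"] cong: if_cong)
  finally show ?thesis .
qed

lemma parseval:
  assumes B: "orthonormal_basis m Q B" and Q: "Q \<in> cubes"
  shows "average Q (\<lambda>x. (\<Sum>\<phi>\<in>B. c \<phi> * \<phi> x) * (\<Sum>\<phi>\<in>B. c \<phi> * \<phi> x)) = (\<Sum>\<phi>\<in>B. (c \<phi>)\<^sup>2)"
proof -
  have B': "finite B" "B \<subseteq> poly_space m"
    using B unfolding orthonormal_basis_def by blast+
  let ?g = "\<lambda>x. \<Sum>\<phi>\<in>B. c \<phi> * \<phi> x"
  have g: "?g \<in> poly_space m"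
    using B' by (intro poly_space_sum poly_space_cmult) auto
  have "average Q (\<lambda>x. \<phi> x * ?g x) = c \<phi>" if "\<phi> \<in> B" for \<phi>
  proof -
    have "(\<lambda>x. \<phi> x * ?g x) = (\<lambda>x. ?g x * \<phi> x)"
      by (simp add: fun_eq_iff mult.commute)
    then show ?thesis
      by (simp only: orthonormal_coefficient[OF B Q that])
  qed
  then show ?thesis
    by (subst average_sum_mult[OF B' g Q]) (simp add: power2_eq_square)
qed

text \<open>On the unit cube, expand in an orthonormal basis and apply Cauchy--Schwarz: the
  coefficients contribute the mean square by Parseval, the basis values at most \<open>M\<close>.
  Affine substitution preserves the polynomial space and the averages, so the same \<open>M\<close>
  serves every cube; it is the source of the dependence on n and m.\<close>

lemma poly_space_sup_average_bound:
  "\<exists>M. \<forall>Q\<in>cubes. \<forall>g\<in>poly_space m. \<forall>x\<in>Q. (g (x :: real^'n))\<^sup>2 \<le> M * average Q (\<lambda>x. g x * g x)"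
proof -
  let ?U = "cube 0 1 :: (real^'n) set"
  have U: "?U \<in> cubes" by auto
  obtain B where B: "orthonormal_basis m ?U B"
    using orthonormal_basis_exists[OF U] by blast
  have B': "finite B" "B \<subseteq> poly_space m" "\<forall>g\<in>poly_space m. \<exists>c. \<forall>x. g x = (\<Sum>\<phi>\<in>B. c \<phi> * \<phi> x)"
    using B unfolding orthonormal_basis_def by blast+
  have "\<exists>K. \<forall>x\<in>?U. \<bar>\<phi> x\<bar> \<le> K" if "\<phi> \<in> B" for \<phi>
  proof -
    have "\<phi> \<in> poly_space m" using that B' by blast
    then have "bounded (\<phi> ` cbox 0 (0 + (\<chi> i. 1)))"
      by (intro compact_imp_bounded compact_continuous_image poly_space_continuous compact_cbox)
    then show ?thesis
      unfolding bounded_iff using cube_subset_cbox[of 0 1] by (metis imageI real_norm_def subsetD)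
  qed
  then obtain K where K: "\<And>\<phi> x. \<phi> \<in> B \<Longrightarrow> x \<in> ?U \<Longrightarrow> \<bar>\<phi> x\<bar> \<le> K \<phi>"
    by metis
  define M where "M = (\<Sum>\<phi>\<in>B. (K \<phi>)\<^sup>2)"
  have unit: "(g x)\<^sup>2 \<le> M * average ?U (\<lambda>x. g x * g x)" if g: "g \<in> poly_space m" and x: "x \<in> ?U" for g x
  proof -
    obtain c where c: "\<And>x. g x = (\<Sum>\<phi>\<in>B. c \<phi> * \<phi> x)"
      using B'(3) g by blast
    have "(g x)\<^sup>2 \<le> (\<Sum>\<phi>\<in>B. (c \<phi>)\<^sup>2) * (\<Sum>\<phi>\<in>B. (\<phi> x)\<^sup>2)"
      unfolding c by (rule Cauchy_Schwarz_ineq_sum)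
    also have "\<dots> \<le> (\<Sum>\<phi>\<in>B. (c \<phi>)\<^sup>2) * M"
    proof (rule mult_left_mono)
      show "(\<Sum>\<phi>\<in>B. (\<phi> x)\<^sup>2) \<le> M"
        unfolding M_def using K[OF _ x] by (intro sum_mono) (metis abs_ge_zero power2_abs power_mono)
    qed (simp add: sum_nonneg)
    finally show ?thesis
      unfolding c parseval[OF B U] by (simp add: mult.commute)
  qed
  have "(g x)\<^sup>2 \<le> M * average Q (\<lambda>x. g x * g x)" if Q: "Q \<in> cubes" and g: "g \<in> poly_space m" and x: "x \<in> Q" for Q :: "(real^'n) set" and g x
  proof -
    obtain c l where cl: "0 < l" "Q = cube c l"
      using Q by (rule cubesE)
    define y where "y = (1 / l) *\<^sub>R (x - c)"
    have "y \<in> ?U"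
      using x cl by (auto simp: y_def cube_def field_simps)
    moreover have "c + l *\<^sub>R y = x"
      using cl by (simp add: y_def)
    ultimately have "(g x)\<^sup>2 \<le> M * average ?U (\<lambda>x. g (c + l *\<^sub>R x) * g (c + l *\<^sub>R x))"
      using unit[OF poly_space_affine[OF g, of c l], of y] by simp
    also have "average ?U (\<lambda>x. g (c + l *\<^sub>R x) * g (c + l *\<^sub>R x)) = average Q (\<lambda>x. g x * g x)"
      unfolding cl(2) by (rule average_cube_affine[symmetric])
        (intro cl borel_measurable_times poly_space_borel[OF g])+
    finally show ?thesis .
  qed
  then show ?thesis by blast
qed

text \<open>Apply the assumed bound to the reproducing kernel at \<open>x\<close>, namely
  \<open>?g\<close>. Its value at \<open>x\<close> and its mean square both equal \<open>?k\<close>,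
  whence the square of \<open>?k\<close> is at most M times \<open>?k\<close>.\<close>

lemma orthonormal_diagonal_bound:
  assumes M: "\<forall>g\<in>poly_space m. \<forall>x\<in>Q. (g x)\<^sup>2 \<le> M * average Q (\<lambda>x. g x * g x)"
    and B: "orthonormal_basis m Q B" and Q: "Q \<in> cubes" and x: "x \<in> Q"
  shows "(\<Sum>\<phi>\<in>B. (\<phi> x)\<^sup>2) \<le> M"
proof -
  let ?k = "\<Sum>\<phi>\<in>B. (\<phi> x)\<^sup>2"
  have B': "B \<subseteq> poly_space m"
    using B unfolding orthonormal_basis_def by blast
  let ?g = "\<lambda>y. \<Sum>\<phi>\<in>B. \<phi> x * \<phi> y"
  have g: "?g \<in> poly_space m"
    using B' by (intro poly_space_sum poly_space_cmult) auto
  have "(?g x)\<^sup>2 \<le> M * average Q (\<lambda>y. ?g y * ?g y)"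
    by (rule M[rule_format, OF g x])
  then have "?k * ?k \<le> M * ?k"
    unfolding parseval[OF B Q] by (simp add: power2_eq_square)
  moreover have "0 \<le> ?k" by (simp add: sum_nonneg)
  \<comment> \<open>The constant polynomial 1 shows this; it settles the case in which
    \<open>?k\<close> is 0 and cannot be cancelled.\<close>
  moreover have "0 \<le> M"
  proof -
    have "1\<^sup>2 \<le> M * average Q (\<lambda>y. 1 * 1)"
      by (rule M[rule_format, OF poly_space_const x])
    moreover have "0 \<le> average Q (\<lambda>y. 1 * 1 :: real)" by (rule average_sq_nonneg)
    ultimately show ?thesis
      by (metis mult_nonpos_nonneg not_le one_power2 order_trans zero_less_one nle_le)
  qed
  ultimately show ?thesis
    by (metis mult_le_cancel_right order_le_less)
qed

section \<open>The projection and its pointwise bound\<close>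

lemma poly_projE:
  assumes "Q \<in> cubes"
  obtains B where "orthonormal_basis m Q B"
    "\<And>f x. poly_proj m Q f x = (\<Sum>\<phi>\<in>B. average Q (\<lambda>y. f y * \<phi> y) * \<phi> x)"
  \<comment> \<open>The chosen basis depends on \<open>m\<close> and \<open>Q\<close> only, so a
    single \<open>B\<close> represents the projections of all \<open>f\<close>.\<close>
  using someI_ex[OF orthonormal_basis_exists[OF assms, of m]] that
  unfolding poly_proj_def Let_def by blast

lemma poly_proj_in_poly_space:
  assumes "Q \<in> cubes"
  shows "poly_proj m Q f \<in> poly_space m"
proof -
  obtain B where B: "orthonormal_basis m Q B"
    "\<And>f x. poly_proj m Q f x = (\<Sum>\<phi>\<in>B. average Q (\<lambda>y. f y * \<phi> y) * \<phi> x)"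
    using poly_projE[OF assms] by blast
  have "B \<subseteq> poly_space m"
    using B(1) unfolding orthonormal_basis_def by blast
  then have "(\<lambda>x. \<Sum>\<phi>\<in>B. average Q (\<lambda>y. f y * \<phi> y) * \<phi> x) \<in> poly_space m"
    by (intro poly_space_sum poly_space_cmult) auto
  then show ?thesis by (simp flip: B(2))
qed

text \<open>The projection is linear and fixes polynomials. With g the projection on a larger cube,
  this turns the difference of two projections of f into one projection of f - g.\<close>

lemma poly_proj_diff_poly:
  assumes Q: "Q \<in> cubes" and f: "set_integrable lebesgue Q f" and g: "g \<in> poly_space m"
  shows "poly_proj m Q (\<lambda>y. f y - g y) x = poly_proj m Q f x - g x"
proof -
  obtain B where B: "orthonormal_basis m Q B"
    "\<And>f x. poly_proj m Q f x = (\<Sum>\<phi>\<in>B. average Q (\<lambda>y. f y * \<phi> y) * \<phi> x)"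
    using poly_projE[OF Q] by blast
  have B': "B \<subseteq> poly_space m"
    using B(1) unfolding orthonormal_basis_def by blast
  obtain c where c: "\<And>x. g x = (\<Sum>\<phi>\<in>B. c \<phi> * \<phi> x)"
    using B(1) g unfolding orthonormal_basis_def by blast
  have "average Q (\<lambda>y. (f y - g y) * \<phi> y) = average Q (\<lambda>y. f y * \<phi> y) - c \<phi>" if "\<phi> \<in> B" for \<phi>
  proof -
    have \<phi>: "\<phi> \<in> poly_space m" using that B' by blast
    have "average Q (\<lambda>y. g y * \<phi> y) = c \<phi>"
      unfolding c by (rule orthonormal_coefficient[OF B(1) Q that])
    then show ?thesis
      unfolding left_diff_distrib
        average_diff[OF set_integrable_mult_poly[OF f \<phi> Q] poly_mult_integrable[OF g \<phi> Q]]
      by simp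
  qed
  then have "poly_proj m Q (\<lambda>y. f y - g y) x = (\<Sum>\<phi>\<in>B. (average Q (\<lambda>y. f y * \<phi> y) - c \<phi>) * \<phi> x)"
    unfolding B(2) by (intro sum.cong) auto
  then show ?thesis
    by (simp add: B(2) c left_diff_distrib sum_subtractf)
qed

lemma average_mono:
  assumes "set_integrable lebesgue Q f" "set_integrable lebesgue Q g" "\<And>x. x \<in> Q \<Longrightarrow> f x \<le> g x"
  shows "average Q f \<le> average Q g"
  unfolding average_def using assms by (intro divide_right_mono set_integral_mono) auto

text \<open>The value at \<open>x\<close> is the average of \<open>h\<close> against the reproducing
  kernel \<open>k\<close>. Cauchy--Schwarz and the diagonal bound at \<open>x\<close> and at
  \<open>y\<close> show that \<open>k\<close> is at most \<open>M\<close> in absolute value on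
  \<open>Q\<close>.\<close>

lemma poly_proj_bound:
  assumes M: "\<forall>g\<in>poly_space m. \<forall>x\<in>Q. (g x)\<^sup>2 \<le> M * average Q (\<lambda>x. g x * g x)"
    and Q: "Q \<in> cubes" and h: "set_integrable lebesgue Q h" and x: "x \<in> Q"
  shows "\<bar>poly_proj m Q h x\<bar> \<le> M * average Q (\<lambda>y. \<bar>h y\<bar>)"
proof -
  obtain B where B: "orthonormal_basis m Q B"
    "\<And>f x. poly_proj m Q f x = (\<Sum>\<phi>\<in>B. average Q (\<lambda>y. f y * \<phi> y) * \<phi> x)"
    using poly_projE[OF Q] by blast
  have B': "finite B" "B \<subseteq> poly_space m"
    using B(1) unfolding orthonormal_basis_def by blast+
  define k where "k = (\<lambda>y. \<Sum>\<phi>\<in>B. \<phi> x * \<phi> y)"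
  have k: "k \<in> poly_space m"
    unfolding k_def using B' by (intro poly_space_sum poly_space_cmult) auto
  have "average Q (\<lambda>y. h y * k y) = average Q (\<lambda>y. \<Sum>\<phi>\<in>B. \<phi> x * (h y * \<phi> y))"
    by (simp add: k_def sum_distrib_left mult_ac)
  also have "\<dots> = (\<Sum>\<phi>\<in>B. average Q (\<lambda>y. \<phi> x * (h y * \<phi> y)))"
    using B' by (intro average_sum set_integrable_mult_right) (auto intro!: set_integrable_mult_poly h Q)
  also have "\<dots> = poly_proj m Q h x"
    unfolding average_cmult B(2) by (simp add: mult.commute)
  finally have eq: "poly_proj m Q h x = average Q (\<lambda>y. h y * k y)" by simp
  have kM: "\<bar>k y\<bar> \<le> M" if y: "y \<in> Q" for y
  proof -
    have M0: "0 \<le> M"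
      using orthonormal_diagonal_bound[OF M B(1) Q x] sum_nonneg[of B "\<lambda>\<phi>. (\<phi> x)\<^sup>2"] by simp
    have "(k y)\<^sup>2 \<le> (\<Sum>\<phi>\<in>B. (\<phi> x)\<^sup>2) * (\<Sum>\<phi>\<in>B. (\<phi> y)\<^sup>2)"
      unfolding k_def by (rule Cauchy_Schwarz_ineq_sum)
    also have "\<dots> \<le> M * M"
      using orthonormal_diagonal_bound[OF M B(1) Q x] orthonormal_diagonal_bound[OF M B(1) Q y]
      by (intro mult_mono M0 sum_nonneg zero_le_power2)
    finally have "\<bar>k y\<bar>\<^sup>2 \<le> M\<^sup>2" by (simp add: power2_eq_square)
    then show ?thesis by (rule power2_le_imp_le[OF _ M0])
  qed
  have "\<bar>h y * k y\<bar> \<le> M * \<bar>h y\<bar>" if "y \<in> Q" for y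
    using mult_right_mono[OF kM[OF that], of "\<bar>h y\<bar>"] by (simp add: abs_mult mult.commute)
  then have *: "h y * k y \<le> M * \<bar>h y\<bar>" "- 1 * (h y * k y) \<le> M * \<bar>h y\<bar>" if "y \<in> Q" for y
    using that by (auto simp: abs_le_iff)
  have hk: "set_integrable lebesgue Q (\<lambda>y. h y * k y)"
    by (rule set_integrable_mult_poly[OF h k Q])
  have ah: "set_integrable lebesgue Q (\<lambda>y. M * \<bar>h y\<bar>)"
    by (intro set_integrable_mult_right set_integrable_abs h)
  have "average Q (\<lambda>y. h y * k y) \<le> average Q (\<lambda>y. M * \<bar>h y\<bar>)"
    by (rule average_mono[OF hk ah *(1)])
  moreover have "average Q (\<lambda>y. - 1 * (h y * k y)) \<le> average Q (\<lambda>y. M * \<bar>h y\<bar>)"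
    by (rule average_mono[OF set_integrable_mult_right[OF hk] ah *(2)])
  ultimately show ?thesis
    unfolding eq average_cmult by (simp add: abs_le_iff)
qed

section \<open>Calderon--Zygmund decomposition\<close>

text \<open>An infinite countable set is enumerated, which makes the integral a series of
  nonnegative terms and hence the supremum of its finite partial sums.\<close>

lemma nn_integral_count_space_le:
  assumes F: "countable F" and le: "\<And>G. finite G \<Longrightarrow> G \<subseteq> F \<Longrightarrow> (\<Sum>R\<in>G. c R) \<le> B"
  shows "(\<integral>\<^sup>+R. c R \<partial>count_space F) \<le> (B :: ennreal)"
proof (cases "finite F")
  case True
  then show ?thesis
    using le[OF True] by (simp add: nn_integral_count_space_finite)
next
  case False
  have bij: "bij_betw (from_nat_into F) UNIV F"
    by (rule bij_betw_from_nat_into[OF F False])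
  then have inj: "inj (from_nat_into F)" and range: "range (from_nat_into F) = F"
    by (auto simp: bij_betw_def)
  have "(\<integral>\<^sup>+R. c R \<partial>count_space F) = (\<Sum>i. c (from_nat_into F i))"
    unfolding nn_integral_bij_count_space[OF bij, symmetric] by (rule nn_integral_count_space_nat)
  also have "\<dots> \<le> B"
    unfolding suminf_eq_SUP
  proof (rule SUP_least)
    fix n
    have "(\<Sum>i<n. c (from_nat_into F i)) = (\<Sum>R\<in>from_nat_into F ` {..<n}. c R)"
      by (subst sum.reindex) (auto intro: inj_on_subset[OF inj])
    also have "\<dots> \<le> B"
      using range by (intro le) auto
    finally show "(\<Sum>i<n. c (from_nat_into F i)) \<le> B" .
  qed
  finally show ?thesis .
qed

lemma emeasure_Union_count_space:
  assumes "countable F" "pairwise disjnt F" "\<And>R. R \<in> F \<Longrightarrow> R \<in> sets M"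
  shows "emeasure M (\<Union>F) = (\<integral>\<^sup>+R. emeasure M R \<partial>count_space F)"
proof -
  have "disjoint_family_on (\<lambda>R. R) F"
    using assms(2) by (auto simp: disjoint_family_on_def pairwise_def disjnt_def)
  from emeasure_UN_countable[OF assms(3,1) this] show ?thesis by simp
qed

text \<open>Countable additivity on both sides. It serves to compare Lebesgue measure with the mass
  of a function on disjoint cubes, in either direction.\<close>

lemma emeasure_Union_le:
  assumes F: "countable F" "pairwise disjnt F" "\<And>R. R \<in> F \<Longrightarrow> R \<in> sets M" "\<And>R. R \<in> F \<Longrightarrow> R \<in> sets N"
    and le: "\<And>R. R \<in> F \<Longrightarrow> emeasure M R \<le> k * emeasure N R"
  shows "emeasure M (\<Union>F) \<le> k * emeasure N (\<Union>F)"
proof -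
  have "emeasure M (\<Union>F) = (\<integral>\<^sup>+R. emeasure M R \<partial>count_space F)"
    by (rule emeasure_Union_count_space[OF F(1,2,3)])
  also have "\<dots> \<le> (\<integral>\<^sup>+R. k * emeasure N R \<partial>count_space F)"
    using le by (intro nn_integral_mono) simp
  also have "\<dots> = k * (\<integral>\<^sup>+R. emeasure N R \<partial>count_space F)"
    by (rule nn_integral_cmult) simp
  also have "\<dots> = k * emeasure N (\<Union>F)"
    by (simp only: emeasure_Union_count_space[OF F(1,2,4)])
  finally show ?thesis .
qed

text \<open>Turns integrals of \<open>g\<close> over subsets of \<open>Q\<close> into values of a
  measure, to which monotonicity and countable additivity apply.\<close>

lemma emeasure_density_indicator:
  fixes g :: "'a \<Rightarrow> real"
  assumes g: "set_integrable M Q g" "\<And>x. 0 \<le> g x" and R: "R \<in> sets M" "R \<subseteq> Q"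
  shows "emeasure (density M (\<lambda>x. ennreal (indicator Q x * g x))) R = ennreal (LINT x:R|M. g x)"
proof -
  have int: "integrable M (\<lambda>x. indicator R x * g x)"
    using set_integrable_subset[OF g(1) R] by (simp add: set_integrable_def)
  have "emeasure (density M (\<lambda>x. ennreal (indicator Q x * g x))) R
      = (\<integral>\<^sup>+x. ennreal (indicator Q x * g x) * indicator R x \<partial>M)"
    using g(1) R(1) by (intro emeasure_density) (auto simp: set_integrable_def)
  also have "\<dots> = (\<integral>\<^sup>+x. ennreal (indicator R x * g x) \<partial>M)"
    using R(2) by (intro nn_integral_cong) (auto simp: indicator_def)
  also have "\<dots> = ennreal (LINT x:R|M. g x)"
    using int g(2) unfolding set_lebesgue_integral_def
    by (subst nn_integral_eq_integral) (auto simp: indicator_def)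
  finally show ?thesis .
qed

lemma emeasure_cubes: "Q \<in> cubes \<Longrightarrow> emeasure lebesgue Q = ennreal (measure lebesgue Q)"
  by (drule cubes_lmeasurable) (simp only: emeasure_eq_measure2 fmeasurableD2)

text \<open>\<open>F\<close> consists of the maximal dyadic subcubes with average above
  \<open>L * \<alpha>\<close>. Each has mass above \<open>L * \<alpha>\<close> times its volume,
  while the total mass is at most \<open>\<alpha>\<close> times that of \<open>Q\<close>; this
  bounds the volume of the union. The parent of a selected cube was rejected and has 2^n times its
  volume, which bounds the averages from above.\<close>

lemma calderon_zygmund:
  fixes g :: "real^'n \<Rightarrow> real"
  assumes Q: "Q \<in> cubes" and g: "set_integrable lebesgue Q g" "\<And>x. 0 \<le> g x"
    and \<alpha>: "0 < \<alpha>" "average Q g \<le> \<alpha>" and L: "1 < L"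
  obtains F where "F \<subseteq> cubes" "countable F" "pairwise disjnt F" "\<And>R. R \<in> F \<Longrightarrow> R \<subseteq> Q"
    "emeasure lebesgue (\<Union>F) \<le> ennreal (1 / L) * emeasure lebesgue Q"
    "\<And>R. R \<in> F \<Longrightarrow> average R g \<le> 2 ^ CARD('n) * (L * \<alpha>)"
    "AE x in lebesgue. x \<in> Q - \<Union>F \<longrightarrow> g x \<le> 2 * (L * \<alpha>)"
proof -
  obtain c l where cl: "0 < l" "Q = cube c l"
    using Q by (rule cubesE)
  define P where "P R \<longleftrightarrow> L * \<alpha> < average R g" for R
  define F where "F = maximal_cells c l P"
  define \<nu> where "\<nu> = density lebesgue (\<lambda>x. ennreal (indicator Q x * g x))"
  have L\<alpha>: "0 < L * \<alpha>" using \<alpha> L by simp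
  have F: "countable F" "pairwise disjnt F" "\<And>R. R \<in> F \<Longrightarrow> R \<in> cubes" "\<And>R. R \<in> F \<Longrightarrow> R \<subseteq> Q"
    "\<And>R. R \<in> F \<Longrightarrow> P R"
    unfolding F_def cl(2) using maximal_cells_subset[OF cl(1)]
    by (simp_all add: maximal_cells_countable maximal_cells_disjoint[OF cl(1)])
  have \<nu>: "emeasure \<nu> R = ennreal (average R g * measure lebesgue R)" if "R \<in> cubes" "R \<subseteq> Q" for R
  proof -
    have "(LINT x:R|lebesgue. g x) = average R g * measure lebesgue R"
      unfolding average_def using cubes_measure_pos[OF that(1)] by (metis nonzero_eq_divide_eq less_irrefl)
    then show ?thesis
      unfolding \<nu>_def emeasure_density_indicator[OF g cubes_lebesgue[OF that(1)] that(2)] by (rule arg_cong)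
  qed
  \<comment> \<open>\<open>Q\<close> itself is rejected, so every selected cube has a parent inside
    \<open>Q\<close>.\<close>
  have nP: "\<not> P Q"
    using mult_strict_right_mono[OF L \<alpha>(1)] \<alpha>(2) by (simp add: P_def)
  have sets_F: "\<Union>F \<in> sets lebesgue"
    using F(1,3) by (intro sets.countable_Union) (auto intro: cubes_lebesgue)
  have sets_\<nu>: "sets \<nu> = sets lebesgue"
    by (simp add: \<nu>_def)
  have \<nu>mono: "emeasure \<nu> A \<le> emeasure \<nu> B" if "A \<subseteq> B" "B \<in> sets lebesgue" for A B
    using that by (intro emeasure_mono) (auto simp: sets_\<nu>)
  have 1: "emeasure lebesgue (\<Union>F) \<le> ennreal (1 / L) * emeasure lebesgue Q"
  proof -
    have "emeasure lebesgue (\<Union>F) \<le> ennreal (1 / (L * \<alpha>)) * emeasure \<nu> (\<Union>F)"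
    proof (rule emeasure_Union_le[OF F(1,2)])
      fix R assume R: "R \<in> F"
      show "R \<in> sets lebesgue" "R \<in> sets \<nu>"
        using F(3)[OF R] by (auto simp: sets_\<nu> intro: cubes_lebesgue)
      have "measure lebesgue R * (L * \<alpha>) \<le> average R g * measure lebesgue R"
        using F(5)[OF R] by (subst mult.commute, intro mult_right_mono) (auto simp: P_def)
      then have "measure lebesgue R \<le> 1 / (L * \<alpha>) * (average R g * measure lebesgue R)"
        unfolding times_divide_eq_left mult_1 by (subst pos_le_divide_eq[OF L\<alpha>])
      then show "emeasure lebesgue R \<le> ennreal (1 / (L * \<alpha>)) * emeasure \<nu> R"
        unfolding \<nu>[OF F(3)[OF R] F(4)[OF R]] emeasure_cubes[OF F(3)[OF R]]
        using L\<alpha> by (subst ennreal_mult'[symmetric]) (auto intro: ennreal_leI)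
    qed
    also have "\<dots> \<le> ennreal (1 / (L * \<alpha>)) * emeasure \<nu> Q"
      using F(4) Q by (intro mult_left_mono \<nu>mono) (auto intro: cubes_lebesgue)
    also have "\<dots> \<le> ennreal (1 / (L * \<alpha>)) * ennreal (\<alpha> * measure lebesgue Q)"
      unfolding \<nu>[OF Q order_refl] using \<alpha>
      by (intro mult_left_mono ennreal_leI mult_right_mono) auto
    also have "\<dots> = ennreal (1 / L * measure lebesgue Q)"
      using \<alpha> L by (subst ennreal_mult'[symmetric]) simp_all
    also have "\<dots> = ennreal (1 / L) * emeasure lebesgue Q"
      unfolding emeasure_cubes[OF Q] using L by (intro ennreal_mult') simp
    finally show ?thesis .
  qed
  have 2: "average R g \<le> 2 ^ CARD('n) * (L * \<alpha>)" if R: "R \<in> F" for R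
  proof -
    obtain R' where R': "R' \<in> cubes" "R \<subseteq> R'" "R' \<subseteq> Q" "\<not> P R'"
      "measure lebesgue R' = 2 ^ CARD('n) * measure lebesgue R"
      using maximal_cells_parent[OF cl(1) R[unfolded F_def]] nP unfolding cl(2) by blast
    have "emeasure \<nu> R \<le> emeasure \<nu> R'"
      using R' by (intro \<nu>mono cubes_lebesgue)
    then have "average R g * measure lebesgue R \<le> average R' g * measure lebesgue R'"
      unfolding \<nu>[OF F(3)[OF R] F(4)[OF R]] \<nu>[OF R'(1,3)]
      by (subst (asm) ennreal_le_iff)
        (auto simp: average_def set_lebesgue_integral_def g(2) intro!: mult_nonneg_nonneg divide_nonneg_nonneg Bochner_Integration.integral_nonneg)
    also have "\<dots> \<le> L * \<alpha> * measure lebesgue R'"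
      using R'(4) by (intro mult_right_mono) (auto simp: P_def)
    also have "\<dots> = 2 ^ CARD('n) * (L * \<alpha>) * measure lebesgue R"
      unfolding R'(5) by (simp only: mult_ac)
    finally show ?thesis
      using cubes_measure_pos[OF F(3)[OF R]] by (rule mult_right_le_imp_le)
  qed
  define E where "E = {x \<in> Q - \<Union>F. 2 * (L * \<alpha>) < g x}"
  have E_sets: "E \<in> sets lebesgue"
  proof -
    have [measurable]: "(\<lambda>x. indicator Q x * g x) \<in> borel_measurable lebesgue"
      using g(1) by (auto simp: set_integrable_def)
    have "{x \<in> space lebesgue. 2 * (L * \<alpha>) < indicator Q x * g x} \<in> sets lebesgue"
      by (intro borel_measurable_less) auto
    moreover have "E = (Q - \<Union>F) \<inter> {x \<in> space lebesgue. 2 * (L * \<alpha>) < indicator Q x * g x}"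
    proof (rule set_eqI)
      fix x
      show "x \<in> E \<longleftrightarrow> x \<in> (Q - \<Union>F) \<inter> {x \<in> space lebesgue. 2 * (L * \<alpha>) < indicator Q x * g x}"
        unfolding E_def by (cases "x \<in> Q") simp_all
    qed
    ultimately show ?thesis
      using cubes_lebesgue[OF Q] sets_F by (simp only: sets.Diff sets.Int)
  qed
  \<comment> \<open>A covering argument in place of Lebesgue differentiation. If \<open>E\<close>
    had positive measure, choose an open \<open>U\<close> around it with |U - E| < |E| and cover
    \<open>E\<close> by disjoint cells \<open>H\<close> inside \<open>U\<close> that meet
    \<open>E\<close>. These have average at most \<open>L * \<alpha>\<close>, so 2 L \<alpha> |E| is
    at most the mass of \<open>\<Union>H\<close>, hence at most L \<alpha> (|E| + |U - E|), which is
    less than 2 L \<alpha> |E|. The factor 2 makes room for U - E.\<close>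
  have "emeasure lebesgue E = 0"
  proof (rule ccontr)
    assume nz: "emeasure lebesgue E \<noteq> 0"
    have "E \<in> lmeasurable"
      by (rule fmeasurableI2[OF cubes_lmeasurable[OF Q] _ E_sets]) (auto simp: E_def)
    then have Em: "emeasure lebesgue E = ennreal (measure lebesgue E)"
      by (simp only: emeasure_eq_measure2 fmeasurableD2)
    with nz have mpos: "0 < measure lebesgue E"
      by (metis ennreal_0 measure_nonneg order_le_less)
    obtain U where U: "open U" "E \<subseteq> U" "U - E \<in> lmeasurable" "emeasure lebesgue (U - E) < ennreal (measure lebesgue E)"
      using sets_lebesgue_outer_open[OF E_sets mpos] by blast
    define H where "H = maximal_cells c l (\<lambda>R. R \<subseteq> U \<and> R \<inter> E \<noteq> {})"
    have H: "countable H" "pairwise disjnt H" "\<And>R. R \<in> H \<Longrightarrow> R \<in> cubes" "\<And>R. R \<in> H \<Longrightarrow> R \<subseteq> Q"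
      "\<And>R. R \<in> H \<Longrightarrow> R \<subseteq> U \<and> R \<inter> E \<noteq> {}"
      unfolding H_def cl(2) using maximal_cells_subset[OF cl(1)]
      by (simp_all add: maximal_cells_countable maximal_cells_disjoint[OF cl(1)])
    have EH: "E \<subseteq> \<Union>H"
    proof
      fix x assume x: "x \<in> E"
      obtain k where "cell c l k x \<subseteq> U"
        using cell_eventually_subset[OF cl(1) U(1)] U(2) x by blast
      moreover have "cell c l k x \<inter> E \<noteq> {}"
        using x mem_cell by blast
      moreover have "x \<in> cube c l"
        using x cl(2) unfolding E_def by blast
      ultimately show "x \<in> \<Union>H"
        unfolding H_def by (intro maximal_cells_cover[of x c l _ k] conjI)
    qed
    \<comment> \<open>A cell with property \<open>P\<close> is contained in the union of the
      stopping cubes, whereas \<open>R\<close> contains a point of \<open>E\<close>, which lies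
      outside that union.\<close>
    have avg: "\<not> P R" if R: "R \<in> H" for R
    proof
      assume "P R"
      obtain y where y: "y \<in> R" "y \<in> E" using H(5)[OF R] by blast
      obtain k x where kx: "R = cell c l k x"
        using R unfolding H_def maximal_cells_def by blast
      then have "R = cell c l k y" using cell_eq y(1) by metis
      with \<open>P R\<close> have "y \<in> \<Union>F"
        using y(2) unfolding F_def E_def cl(2) by (intro maximal_cells_cover[of y c l P k]) auto
      with y(2) show False by (auto simp: E_def)
    qed
    have "ennreal (2 * (L * \<alpha>)) * emeasure lebesgue E = (\<integral>\<^sup>+x. ennreal (2 * (L * \<alpha>)) * indicator E x \<partial>lebesgue)"
      using E_sets by (rule nn_integral_cmult_indicator[symmetric])
    also have "\<dots> \<le> (\<integral>\<^sup>+x. ennreal (indicator Q x * g x) * indicator E x \<partial>lebesgue)"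
      by (intro nn_integral_mono) (auto simp: E_def indicator_def intro!: ennreal_leI)
    also have "\<dots> = emeasure \<nu> E"
      unfolding \<nu>_def using g(1) E_sets by (intro emeasure_density[symmetric]) (auto simp: set_integrable_def)
    also have "\<dots> \<le> emeasure \<nu> (\<Union>H)"
      using H(1,3) by (intro \<nu>mono EH sets.countable_Union) (auto intro: cubes_lebesgue)
    also have "\<dots> \<le> ennreal (L * \<alpha>) * emeasure lebesgue (\<Union>H)"
    proof (rule emeasure_Union_le[OF H(1,2)])
      fix R assume R: "R \<in> H"
      show "R \<in> sets lebesgue" "R \<in> sets \<nu>"
        using H(3)[OF R] by (auto simp: sets_\<nu> intro: cubes_lebesgue)
      have "average R g * measure lebesgue R \<le> L * \<alpha> * measure lebesgue R"
        using avg[OF R] by (intro mult_right_mono) (auto simp: P_def)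
      then show "emeasure \<nu> R \<le> ennreal (L * \<alpha>) * emeasure lebesgue R"
        unfolding \<nu>[OF H(3)[OF R] H(4)[OF R]] emeasure_cubes[OF H(3)[OF R]]
        using L\<alpha> by (subst ennreal_mult'[symmetric]) (auto intro: ennreal_leI)
    qed
    also have "\<dots> \<le> ennreal (L * \<alpha>) * (emeasure lebesgue E + emeasure lebesgue (U - E))"
    proof (intro mult_left_mono)
      have UE: "U - E \<in> sets lebesgue"
        using U(3) by (rule fmeasurableD)
      have "emeasure lebesgue (\<Union>H) \<le> emeasure lebesgue (E \<union> (U - E))"
        using H(5) by (intro emeasure_mono sets.Un E_sets UE) auto
      also have "\<dots> \<le> emeasure lebesgue E + emeasure lebesgue (U - E)"
        by (intro emeasure_subadditive E_sets UE)
      finally show "emeasure lebesgue (\<Union>H) \<le> emeasure lebesgue E + emeasure lebesgue (U - E)" .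
    qed simp
    finally have le: "ennreal (2 * (L * \<alpha>)) * emeasure lebesgue E
      \<le> ennreal (L * \<alpha>) * (emeasure lebesgue E + emeasure lebesgue (U - E))" .
    have d: "emeasure lebesgue (U - E) = ennreal (measure lebesgue (U - E))"
      using U(3) by (simp only: emeasure_eq_measure2 fmeasurableD2)
    have "measure lebesgue (U - E) < measure lebesgue E"
      using U(4) unfolding d by (simp only: ennreal_less_iff measure_nonneg)
    moreover have "2 * (L * \<alpha>) * measure lebesgue E \<le> L * \<alpha> * (measure lebesgue E + measure lebesgue (U - E))"
    proof -
      have "ennreal (2 * (L * \<alpha>) * measure lebesgue E) \<le> ennreal (L * \<alpha> * (measure lebesgue E + measure lebesgue (U - E)))"
        using le L\<alpha> unfolding Em d
        by (subst ennreal_mult', simp, subst ennreal_mult', simp, subst ennreal_plus) simp_all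
      then show ?thesis
        by (rule ennreal_le_iff[THEN iffD1, rotated]) (use L \<alpha>(1) in \<open>intro mult_nonneg_nonneg add_nonneg_nonneg measure_nonneg; simp\<close>)
    qed
    then have "L * \<alpha> * (2 * measure lebesgue E) \<le> L * \<alpha> * (measure lebesgue E + measure lebesgue (U - E))"
      by (simp only: mult_ac)
    then have "2 * measure lebesgue E \<le> measure lebesgue E + measure lebesgue (U - E)"
      using L\<alpha> by (rule mult_left_le_imp_le)
    ultimately show False by linarith
  qed
  then have "E \<in> null_sets lebesgue"
    using E_sets by (intro null_setsI)
  then have "AE x in lebesgue. x \<notin> E"
    by (rule AE_not_in)
  then have 3: "AE x in lebesgue. x \<in> Q - \<Union>F \<longrightarrow> g x \<le> 2 * (L * \<alpha>)"
    by eventually_elim (auto simp: E_def)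
  show thesis
    using that[OF _ F(1,2,4) 1 2 3] F(3) by blast
qed

section \<open>Consequences of the smallness condition\<close>

lemma locally_integrable_cubes:
  assumes "locally_integrable f" "Q \<in> cubes"
  shows "set_integrable lebesgue Q f"
proof -
  obtain c l where cl: "Q = cube c l" using assms(2) by (rule cubesE)
  have "set_integrable lebesgue (cbox c (c + (\<chi> i. l))) f"
    using assms(1) compact_cbox unfolding locally_integrable_def by blast
  then show ?thesis
    by (rule set_integrable_subset) (use cl assms(2) cubes_lebesgue cube_subset_cbox in auto)
qed

text \<open>The truncations to balls of radius \<open>k\<close> are measurable and at each point
  eventually equal to \<open>f\<close>.\<close>

lemma locally_integrable_measurable:
  fixes f :: "real^'n \<Rightarrow> real"
  assumes "locally_integrable f"
  shows "f \<in> borel_measurable lebesgue"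
proof (rule borel_measurable_LIMSEQ_real)
  fix k :: nat
  have "set_integrable lebesgue (cball 0 (real k)) f"
    using assms compact_cball unfolding locally_integrable_def by blast
  then show "(\<lambda>x. indicator (cball 0 (real k)) x *\<^sub>R f x) \<in> borel_measurable lebesgue"
    unfolding set_integrable_def by (rule borel_measurable_integrable)
next
  fix x :: "real^'n"
  have "\<forall>\<^sub>F k in sequentially. indicator (cball 0 (real k)) x *\<^sub>R f x = f x"
    using eventually_ge_at_top[of "nat \<lceil>norm x\<rceil>"]
    by eventually_elim (simp add: nat_ceiling_le_eq)
  then show "(\<lambda>k. indicator (cball 0 (real k)) x *\<^sub>R f x) \<longlonglongrightarrow> f x"
    by (rule tendsto_eventually)
qed

lemma A_infinity_weight: "A_infinity w \<Longrightarrow> weight w"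
  and A_infinity_pos: "A_infinity w \<Longrightarrow> AE x in lebesgue. 0 < w x"
  by (auto simp: A_infinity_def Muckenhoupt_def)

text \<open>A zero integral would make \<open>w\<close> vanish almost everywhere on
  \<open>Q\<close>; since \<open>w\<close> is positive almost everywhere, \<open>Q\<close> would be
  a null set.\<close>

lemma wmeasure_pos:
  assumes w: "weight w" and pos: "AE x in lebesgue. 0 < w x" and Q: "Q \<in> cubes"
  shows "0 < wmeasure w Q"
proof -
  have int: "integrable lebesgue (\<lambda>x. indicator Q x *\<^sub>R w x)"
    using locally_integrable_cubes[OF _ Q] w by (auto simp: weight_def set_integrable_def)
  have nn: "0 \<le> indicator Q x *\<^sub>R w x" for x
    using w by (auto simp: weight_def)
  have "wmeasure w Q \<noteq> 0"
  proof
    assume "wmeasure w Q = 0"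
    then have "AE x in lebesgue. indicator Q x *\<^sub>R w x = 0"
      unfolding wmeasure_def set_lebesgue_integral_def
      using integral_nonneg_eq_0_iff_AE[OF int] nn by blast
    with pos have "AE x in lebesgue. x \<notin> Q"
      by eventually_elim (auto simp: indicator_def split: if_splits)
    then have "Q \<in> null_sets lebesgue"
      using AE_iff_null_sets[OF cubes_lebesgue[OF Q]] by blast
    then show False
      using cubes_measure_pos[OF Q] by (simp add: null_sets_def measure_def del: measure_completion emeasure_completion)
  qed
  moreover have "0 \<le> wmeasure w Q"
    unfolding wmeasure_def set_lebesgue_integral_def using nn by (rule Bochner_Integration.integral_nonneg)
  ultimately show ?thesis by linarith
qed

text \<open>For a finite disjoint family the infinite sums are ordinary ones and the total volume is
  the measure of the union. Countable families are later exhausted by finite ones.\<close>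

lemma SD_bound_finite:
  assumes SD: "SD_bound s p w a C" and Q: "Q \<in> cubes" and L: "1 < L"
    and G: "finite G" "G \<subseteq> cubes" "pairwise disjnt G" "\<And>R. R \<in> G \<Longrightarrow> R \<subseteq> Q"
    and le: "emeasure lebesgue (\<Union>G) \<le> ennreal (1 / L) * emeasure lebesgue Q"
  shows "(\<Sum>R\<in>G. a R powr p * wmeasure w R) \<le> C powr p * (1 / L) powr (p / s) * (a Q powr p * wmeasure w Q)"
proof -
  have "ennreal (\<Sum>R\<in>G. measure lebesgue R) = (\<Sum>R\<in>G. ennreal (measure lebesgue R))"
    by (rule sum_ennreal[symmetric]) simp
  also have "\<dots> = (\<Sum>R\<in>G. emeasure lebesgue R)"
    using G(2) by (intro sum.cong refl emeasure_cubes[symmetric]) auto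
  also have "\<dots> = emeasure lebesgue (\<Union>G)"
  proof -
    have "R \<in> sets lebesgue" if "R \<in> G" for R
      using that G(2) cubes_lebesgue by blast
    from emeasure_Union_count_space[OF countable_finite[OF G(1)] G(3) this] show ?thesis
      by (simp only: nn_integral_count_space_finite[OF G(1)])
  qed
  also have "\<dots> \<le> ennreal (1 / L) * ennreal (measure lebesgue Q)"
    using le unfolding emeasure_cubes[OF Q] .
  also have "\<dots> = ennreal (measure lebesgue Q / L)"
    using L by (subst ennreal_mult'[symmetric]) auto
  finally have "(\<Sum>R\<in>G. measure lebesgue R) \<le> measure lebesgue Q / L"
    using L by (subst (asm) ennreal_le_iff) auto
  then have "G \<subseteq> cubes \<and> pairwise disjnt G \<and> (\<forall>R\<in>G. R \<subseteq> Q) \<and>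
      (\<Sum>\<^sub>\<infinity>R\<in>G. measure lebesgue R) \<le> measure lebesgue Q / L"
    unfolding infsum_finite[OF G(1)] using G(2,3,4) by blast
  from SD[unfolded SD_bound_def, THEN spec, THEN mp, OF L, THEN bspec, OF Q, THEN spec, THEN mp, OF this]
  show ?thesis
    unfolding infsum_finite[OF G(1)] by (rule conjunct2)
qed

text \<open>The condition applied to a single cube inside a larger one gives
  \<open>b r \<le> C powr p * b r'\<close>. Inserting arbitrarily many intermediate cubes multiplies
  by arbitrarily high powers of \<open>C powr p\<close>, so \<open>C < 1\<close> would force
  \<open>b 1\<close> to be at most 0.\<close>

lemma SD_bound_ge_1:
  fixes w :: "real^'n \<Rightarrow> real"
  assumes SD: "SD_bound s p w a C" and C: "0 \<le> C" and p: "1 \<le> p" and s: "1 < s"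
    and a: "\<And>Q. Q \<in> cubes \<Longrightarrow> 0 < a Q" and w: "\<And>Q. Q \<in> cubes \<Longrightarrow> 0 < wmeasure w Q"
  shows "1 \<le> C"
proof (rule ccontr)
  assume "\<not> 1 \<le> C"
  then have C1: "C < 1" by simp
  define b where "b r = a (cube 0 r) powr p * wmeasure w (cube 0 r)" for r
  have b: "0 < b r" if "0 < r" for r
    using a[OF cubeI[OF that, of 0]] w[OF cubeI[OF that, of 0]] by (simp add: b_def)
  have step: "b r \<le> C powr p * b r'" if r: "0 < r" "r < r'" for r r'
  proof -
    \<comment> \<open>The exact ratio of the volumes, so that the one-element family is admissible.
      The factor \<open>(1 / L) powr (p / s)\<close> is afterwards bounded by 1.\<close>
    define L where "L = (r' / r) ^ CARD('n)"
    have L: "1 < L" using r by (simp add: L_def)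
    have r': "0 < r'" using r by simp
    have "(\<Sum>R\<in>{cube 0 r}. a R powr p * wmeasure w R)
        \<le> C powr p * (1 / L) powr (p / s) * (a (cube 0 r') powr p * wmeasure w (cube 0 r'))"
    proof (rule SD_bound_finite[OF SD cubeI[OF r'] L])
      show "R \<subseteq> cube 0 r'" if "R \<in> {cube 0 r}" for R
        using that r by (auto simp: cube_def intro: less_trans)
      show "emeasure lebesgue (\<Union>{cube (0 :: real^'n) r}) \<le> ennreal (1 / L) * emeasure lebesgue (cube (0 :: real^'n) r')"
        using r r' L unfolding ccpo_Sup_singleton emeasure_cube[OF r(1)] emeasure_cube[OF r']
        by (subst ennreal_mult'[symmetric]) (auto simp: L_def power_divide)
    qed (use r in auto)
    then have "b r \<le> C powr p * (1 / L) powr (p / s) * b r'"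
      by (simp add: b_def)
    also have "\<dots> \<le> C powr p * 1 * b r'"
      using L p s b[OF r'] by (intro mult_right_mono mult_left_mono powr_le1) auto
    finally show ?thesis by simp
  qed
  have iter: "b r \<le> (C powr p) ^ Suc k * b r'" if "0 < r" "r < r'" for k r r'
    using that
  proof (induction k arbitrary: r)
    case 0
    then show ?case using step by simp
  next
    case (Suc k)
    define t where "t = (r + r') / 2"
    have t: "0 < t" "r < t" "t < r'" using Suc.prems by (auto simp: t_def)
    have "b r \<le> C powr p * b t" using step Suc.prems(1) t(2) by blast
    also have "\<dots> \<le> C powr p * ((C powr p) ^ Suc k * b r')"
      using Suc.IH[OF t(1,3)] by (intro mult_left_mono) auto
    finally show ?case by simp
  qed
  have Cp: "C powr p < 1"
    using powr_less_mono2[of p C 1] C C1 p by simp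
  have "(\<lambda>k. (C powr p) ^ Suc k * b 2) \<longlonglongrightarrow> 0 * b 2"
    using Cp by (intro tendsto_mult LIMSEQ_power_zero[THEN LIMSEQ_Suc] tendsto_const) auto
  then have "b 1 \<le> 0 * b 2"
    by (rule LIMSEQ_le_const) (use iter[of 1 2] in auto)
  with b[of 1] show False by simp
qed

section \<open>Two inequalities for summing over generations\<close>

text \<open>Jensen's inequality for the p-th power with weights \<open>\<mu> i / T\<close>, applied
  to the quotients \<open>A i / \<mu> i\<close>. It separates the p-th power of a sum into terms
  that can be integrated one by one.\<close>

lemma powr_sum_le_weighted:
  fixes A \<mu> :: "'i \<Rightarrow> real"
  assumes I: "finite I" and p: "1 \<le> p" and pos: "\<And>i. i \<in> I \<Longrightarrow> 0 < A i" "\<And>i. i \<in> I \<Longrightarrow> 0 < \<mu> i"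
    and \<Lambda>: "(\<Sum>i\<in>I. \<mu> i) \<le> \<Lambda>"
  shows "(\<Sum>i\<in>I. A i) powr p \<le> \<Lambda> powr (p - 1) * (\<Sum>i\<in>I. \<mu> i powr (1 - p) * A i powr p)"
proof (cases "I = {}")
  case False
  define T where "T = (\<Sum>i\<in>I. \<mu> i)"
  have T: "0 < T" unfolding T_def using I False pos by (intro sum_pos)
  have "(\<Sum>i\<in>I. (\<mu> i / T) *\<^sub>R (A i / \<mu> i)) powr p \<le> (\<Sum>i\<in>I. \<mu> i / T * (A i / \<mu> i) powr p)"
    using pos T
    by (intro convex_on_sum[OF I False powr_convex[OF p]])
      (auto simp: T_def sum_divide_distrib[symmetric] less_imp_le)
  also have "(\<Sum>i\<in>I. (\<mu> i / T) *\<^sub>R (A i / \<mu> i)) = (\<Sum>i\<in>I. A i) / T"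
    unfolding sum_divide_distrib using pos(2) by (intro sum.cong) (auto simp: less_imp_neq[symmetric])
  also have "(\<Sum>i\<in>I. \<mu> i / T * (A i / \<mu> i) powr p) = (\<Sum>i\<in>I. \<mu> i powr (1 - p) * A i powr p) / T"
    unfolding sum_divide_distrib
  proof (intro sum.cong refl)
    fix i assume i: "i \<in> I"
    have "\<mu> i * (A i / \<mu> i) powr p = \<mu> i powr (1 - p) * A i powr p"
      using pos[OF i] by (simp add: powr_divide powr_diff)
    then show "\<mu> i / T * (A i / \<mu> i) powr p = \<mu> i powr (1 - p) * A i powr p / T"
      by simp
  qed
  finally have "((\<Sum>i\<in>I. A i) / T) powr p \<le> (\<Sum>i\<in>I. \<mu> i powr (1 - p) * A i powr p) / T" .
  then have "T powr p * ((\<Sum>i\<in>I. A i) / T) powr p \<le> T powr p * ((\<Sum>i\<in>I. \<mu> i powr (1 - p) * A i powr p) / T)"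
    by (intro mult_left_mono) auto
  moreover have "T powr p * ((\<Sum>i\<in>I. A i) / T) powr p = (\<Sum>i\<in>I. A i) powr p"
    using T pos(1) by (simp add: powr_divide sum_nonneg less_imp_le)
  moreover have "T powr p * ((\<Sum>i\<in>I. \<mu> i powr (1 - p) * A i powr p) / T)
      = T powr (p - 1) * (\<Sum>i\<in>I. \<mu> i powr (1 - p) * A i powr p)"
    using T by (simp add: powr_diff)
  ultimately have "(\<Sum>i\<in>I. A i) powr p \<le> T powr (p - 1) * (\<Sum>i\<in>I. \<mu> i powr (1 - p) * A i powr p)"
    by simp
  also have "\<dots> \<le> \<Lambda> powr (p - 1) * (\<Sum>i\<in>I. \<mu> i powr (1 - p) * A i powr p)"
    using T \<Lambda> p by (intro mult_right_mono powr_mono2 sum_nonneg) (auto simp: T_def)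
  finally show ?thesis .
qed simp

text \<open>A geometric series with ratio \<open>q\<close>. From
  \<open>exp (1 / s) \<ge> 1 + 1 / s\<close> one gets \<open>1 - q \<ge> 1 / (1 + s)\<close>. This
  is the origin of the linear factor s in the final estimate.\<close>

lemma sum_exp_le:
  assumes "1 < s"
  shows "(\<Sum>i\<in>{..<n}. exp (- real i / s)) \<le> 1 + s"
proof -
  define q where "q = exp (- 1 / s)"
  have q: "0 < q" "q < 1" using assms by (auto simp: q_def)
  have "exp (1 / s) \<ge> 1 + 1 / s" by (rule exp_ge_add_one_self)
  then have "q \<le> 1 / (1 + 1 / s)"
    using assms by (simp add: q_def exp_minus divide_inverse le_imp_inverse_le add_pos_pos)
  also have "\<dots> = s / (1 + s)" using assms by (simp add: field_simps)
  finally have q1: "1 / (1 + s) \<le> 1 - q" using assms by (simp add: field_simps)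
  have "(\<Sum>i\<in>{..<n}. exp (- real i / s)) = (\<Sum>i\<in>{..<n}. q ^ i)"
    by (intro sum.cong refl) (simp add: q_def flip: exp_of_nat_mult)
  also have "\<dots> = (1 - q ^ n) / (1 - q)" using q by (simp add: sum_gp_strict)
  also have "\<dots> \<le> 1 / (1 - q)" using q by (intro divide_right_mono) auto
  also have "\<dots> \<le> 1 / (1 / (1 + s))" using q1 assms by (intro divide_left_mono) (auto intro: mult_pos_pos q simp: q)
  finally show ?thesis by simp
qed

section \<open>Generations of stopping cubes\<close>

text \<open>The decomposition is applied to the absolute value of f minus its projection on
  \<open>Q\<close>. On a stopping cube the two projections differ by the projection of that
  difference, which is at most \<open>M\<close> times its average there.\<close>

lemma stopping_cubes:
  fixes f :: "real^'n \<Rightarrow> real"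
  assumes M: "\<forall>Q\<in>cubes. \<forall>g\<in>poly_space m. \<forall>x\<in>Q. (g (x :: real^'n))\<^sup>2 \<le> M * average Q (\<lambda>x. g x * g x)" "0 \<le> M"
    and f: "locally_integrable f" and Q: "Q \<in> cubes"
    and \<alpha>: "0 < \<alpha>" "average Q (\<lambda>x. \<bar>f x - poly_proj m Q f x\<bar>) \<le> \<alpha>" and L: "1 < L"
  obtains F where "F \<subseteq> cubes" "countable F" "pairwise disjnt F" "\<And>R. R \<in> F \<Longrightarrow> R \<subseteq> Q"
    "emeasure lebesgue (\<Union>F) \<le> ennreal (1 / L) * emeasure lebesgue Q"
    "\<And>R x. R \<in> F \<Longrightarrow> x \<in> R \<Longrightarrow>
      \<bar>f x - poly_proj m Q f x\<bar> \<le> \<bar>f x - poly_proj m R f x\<bar> + M * (2 ^ CARD('n) * (L * \<alpha>))"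
    "AE x in lebesgue. x \<in> Q - \<Union>F \<longrightarrow> \<bar>f x - poly_proj m Q f x\<bar> \<le> 2 * (L * \<alpha>)"
proof -
  define g where "g = poly_proj m Q f"
  have g: "g \<in> poly_space m"
    unfolding g_def by (rule poly_proj_in_poly_space[OF Q])
  have fg: "set_integrable lebesgue R (\<lambda>x. f x - g x)" if "R \<in> cubes" for R
    by (rule set_integral_diff(1)[OF locally_integrable_cubes[OF f that] poly_space_integrable[OF g that]])
  obtain F where F: "F \<subseteq> cubes" "countable F" "pairwise disjnt F" "\<And>R. R \<in> F \<Longrightarrow> R \<subseteq> Q"
    "emeasure lebesgue (\<Union>F) \<le> ennreal (1 / L) * emeasure lebesgue Q"
    "\<And>R. R \<in> F \<Longrightarrow> average R (\<lambda>x. \<bar>f x - g x\<bar>) \<le> 2 ^ CARD('n) * (L * \<alpha>)"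
    "AE x in lebesgue. x \<in> Q - \<Union>F \<longrightarrow> \<bar>f x - g x\<bar> \<le> 2 * (L * \<alpha>)"
    by (rule calderon_zygmund[OF Q set_integrable_abs[OF fg[OF Q]] abs_ge_zero \<alpha>(1) \<alpha>(2)[folded g_def] L])
      (rule that)
  have local_bound: "\<bar>f x - g x\<bar> \<le> \<bar>f x - poly_proj m R f x\<bar> + M * (2 ^ CARD('n) * (L * \<alpha>))"
    if R: "R \<in> F" and x: "x \<in> R" for R x
  proof -
    have Rc: "R \<in> cubes" using F(1) R by blast
    have "\<bar>poly_proj m R f x - g x\<bar> = \<bar>poly_proj m R (\<lambda>y. f y - g y) x\<bar>"
      by (simp only: poly_proj_diff_poly[OF Rc locally_integrable_cubes[OF f Rc] g])
    also have "\<dots> \<le> M * average R (\<lambda>y. \<bar>f y - g y\<bar>)"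
      using M(1) Rc by (intro poly_proj_bound[OF _ Rc fg[OF Rc] x]) blast
    also have "\<dots> \<le> M * (2 ^ CARD('n) * (L * \<alpha>))"
      by (intro mult_left_mono F(6) R M(2))
    finally show ?thesis by linarith
  qed
  show thesis
    by (rule that[OF F(1,2,3,4,5) local_bound[unfolded g_def] F(7)[unfolded g_def]])
qed

section \<open>The tree of stopping cubes below a fixed cube\<close>

fun generation :: "((real^'n) set \<Rightarrow> (real^'n) set set) \<Rightarrow> (real^'n) set \<Rightarrow> nat \<Rightarrow> (real^'n) set set" where
  "generation S Q 0 = {Q}"
| "generation S Q (Suc j) = (\<Union>R\<in>generation S Q j. S R)"

context
  fixes S :: "(real^'n) set \<Rightarrow> (real^'n) set set" and Q :: "(real^'n) set" and L :: real
  assumes S: "\<And>R. R \<in> cubes \<Longrightarrow> S R \<subseteq> cubes" "\<And>R. R \<in> cubes \<Longrightarrow> countable (S R)"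
      "\<And>R. R \<in> cubes \<Longrightarrow> pairwise disjnt (S R)" "\<And>R R'. R \<in> cubes \<Longrightarrow> R' \<in> S R \<Longrightarrow> R' \<subseteq> R"
      "\<And>R. R \<in> cubes \<Longrightarrow> emeasure lebesgue (\<Union>(S R)) \<le> ennreal (1 / L) * emeasure lebesgue R"
    and Q: "Q \<in> cubes"
begin

lemma generation_cubes: "generation S Q j \<subseteq> cubes"
  by (induction j) (use Q S(1) in auto)

lemma generation_countable: "countable (generation S Q j)"
  by (induction j) (use generation_cubes S(2) in auto)

lemma generation_subset: "R \<in> generation S Q j \<Longrightarrow> R \<subseteq> Q"
proof (induction j arbitrary: R)
  case (Suc j)
  then obtain P where P: "P \<in> generation S Q j" "R \<in> S P" by auto
  with S(4)[of P R] generation_cubes Suc.IH show ?case by blast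
qed simp

lemma generation_disjoint: "pairwise disjnt (generation S Q j)"
proof (induction j)
  case (Suc j)
  show ?case
  proof (rule pairwiseI)
    fix R R' assume "R \<in> generation S Q (Suc j)" "R' \<in> generation S Q (Suc j)" "R \<noteq> R'"
    then obtain P P' where P: "P \<in> generation S Q j" "R \<in> S P" "P' \<in> generation S Q j" "R' \<in> S P'"
      by auto
    then have c: "P \<in> cubes" "P' \<in> cubes" using generation_cubes by blast+
    show "disjnt R R'"
    proof (cases "P = P'")
      case True
      then show ?thesis using S(3)[OF c(1)] P \<open>R \<noteq> R'\<close> by (simp add: pairwise_def)
    next
      case False
      then have "disjnt P P'" using Suc P by (simp add: pairwise_def)
      then show ?thesis using S(4)[OF c(1) P(2)] S(4)[OF c(2) P(4)] unfolding disjnt_def by blast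
    qed
  qed
qed simp

text \<open>The children of each cube cover at most the fraction 1 / L of it, and disjointness of
  the parents lets these bounds be added up.\<close>

lemma generation_emeasure:
  "emeasure lebesgue (\<Union>(generation S Q j)) \<le> ennreal (1 / L) ^ j * emeasure lebesgue Q"
proof (induction j)
  case (Suc j)
  let ?G = "generation S Q j"
  have sub: "\<And>R. R \<in> ?G \<Longrightarrow> \<Union>(S R) \<subseteq> R" "\<And>R. R \<in> ?G \<Longrightarrow> R \<in> cubes"
    using S(4) generation_cubes by blast+
  have sets: "\<And>R. R \<in> ?G \<Longrightarrow> \<Union>(S R) \<in> sets lebesgue"
    using sub(2) S(1,2) cubes_lebesgue by (intro sets.countable_Union) blast+
  have disj: "disjoint_family_on (\<lambda>R. \<Union>(S R)) ?G"
    unfolding disjoint_family_on_def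
  proof (intro ballI impI)
    fix R R' assume R: "R \<in> ?G" "R' \<in> ?G" "R \<noteq> R'"
    then have "R \<inter> R' = {}" using generation_disjoint[of j] by (simp add: pairwise_def disjnt_def)
    with sub(1) R show "\<Union>(S R) \<inter> \<Union>(S R') = {}" by blast
  qed
  have "emeasure lebesgue (\<Union>(generation S Q (Suc j))) = emeasure lebesgue (\<Union>R\<in>?G. \<Union>(S R))"
    by (rule arg_cong[where f = "emeasure lebesgue"]) auto
  also have "\<dots> = (\<integral>\<^sup>+R. emeasure lebesgue (\<Union>(S R)) \<partial>count_space ?G)"
    by (rule emeasure_UN_countable[OF sets generation_countable disj])
  also have "\<dots> \<le> (\<integral>\<^sup>+R. ennreal (1 / L) * emeasure lebesgue R \<partial>count_space ?G)"
    using S(5) sub(2) by (intro nn_integral_mono) (simp only: space_count_space)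
  also have "\<dots> = ennreal (1 / L) * (\<integral>\<^sup>+R. emeasure lebesgue R \<partial>count_space ?G)"
    by (rule nn_integral_cmult) simp
  also have "\<dots> = ennreal (1 / L) * emeasure lebesgue (\<Union>?G)"
    by (subst emeasure_Union_count_space[OF generation_countable generation_disjoint])
      (use sub(2) cubes_lebesgue in auto)
  also have "\<dots> \<le> ennreal (1 / L) * (ennreal (1 / L) ^ j * emeasure lebesgue Q)"
    by (intro mult_left_mono Suc) simp
  finally show ?case by (simp only: power_Suc mult.assoc)
qed simp

lemma AE_not_in_all_generations:
  assumes L: "1 < L"
  shows "AE x in lebesgue. \<exists>j. x \<notin> \<Union>(generation S Q j)"
proof -
  let ?N = "\<Inter>j. \<Union>(generation S Q j)"
  have sets: "\<Union>(generation S Q j) \<in> sets lebesgue" for j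
    using generation_cubes cubes_lebesgue by (intro sets.countable_Union generation_countable) blast
  have N: "?N \<in> sets lebesgue"
    using sets by (intro sets.countable_INT) auto
  have le: "measure lebesgue ?N \<le> (1 / L) ^ j * measure lebesgue Q" for j
  proof -
    have "emeasure lebesgue ?N \<le> emeasure lebesgue (\<Union>(generation S Q j))"
      by (intro emeasure_mono sets) auto
    also have "\<dots> \<le> ennreal (1 / L) ^ j * emeasure lebesgue Q"
      by (rule generation_emeasure)
    also have "\<dots> = ennreal ((1 / L) ^ j * measure lebesgue Q)"
      using L unfolding emeasure_cubes[OF Q] by (subst ennreal_mult') (simp_all add: ennreal_power)
    finally show ?thesis
      unfolding measure_def[of _ ?N]
      by (intro enn2real_leI mult_nonneg_nonneg zero_le_power measure_nonneg) (use L in simp_all)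
  qed
  have "(\<lambda>j. (1 / L) ^ j * measure lebesgue Q) \<longlonglongrightarrow> 0 * measure lebesgue Q"
    using L by (intro tendsto_intros LIMSEQ_power_zero) auto
  then have "measure lebesgue ?N \<le> 0 * measure lebesgue Q"
    by (rule LIMSEQ_le_const) (use le in auto)
  \<comment> \<open>Generation 0 is \<open>{Q}\<close>, so \<open>?N\<close> lies in
    \<open>Q\<close>. Finiteness is essential, because \<open>measure\<close> is 0 by default on
    sets of infinite measure.\<close>
  moreover have "?N \<in> lmeasurable"
    by (rule fmeasurableI2[OF cubes_lmeasurable[OF Q] _ N]) (use generation.simps(1)[of S Q] in blast)
  ultimately have "?N \<in> null_sets lebesgue"
    using measure_nonneg[of lebesgue ?N] by (simp add: null_setsI emeasure_eq_measure2 N del: emeasure_completion measure_completion)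
  then have "AE x in lebesgue. x \<notin> ?N"
    by (rule AE_not_in)
  then show ?thesis by eventually_elim simp
qed

text \<open>Telescoping along the ancestors of \<open>R\<close>, with \<open>r i\<close> the
  ancestor in generation \<open>i\<close>. Each passage from a cube to its child costs
  \<open>K\<close> times \<open>a\<close> of the parent, so the sum stops before \<open>j\<close>
  and the cube \<open>R\<close> is left to the last term.\<close>

lemma generation_chain:
  fixes h :: "(real^'n) set \<Rightarrow> real^'n \<Rightarrow> real"
  assumes h: "\<And>R R' x. R \<in> cubes \<Longrightarrow> R' \<in> S R \<Longrightarrow> x \<in> R' \<Longrightarrow> h R x \<le> h R' x + K * a R"
    and R: "R \<in> generation S Q j" "x \<in> R"
  shows "\<exists>r. (\<forall>i\<le>j. r i \<in> generation S Q i \<and> x \<in> r i) \<and> r j = R \<and> h Q x \<le> K * (\<Sum>i<j. a (r i)) + h R x"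
  using R
proof (induction j arbitrary: R)
  case 0
  then show ?case by (intro exI[of _ "\<lambda>_. Q"]) simp
next
  case (Suc j)
  then obtain P where P: "P \<in> generation S Q j" "R \<in> S P" by auto
  then have Pc: "P \<in> cubes" using generation_cubes by blast
  have xP: "x \<in> P" using S(4)[OF Pc P(2)] Suc.prems(2) by blast
  obtain r where r: "\<forall>i\<le>j. r i \<in> generation S Q i \<and> x \<in> r i" "r j = P" "h Q x \<le> K * (\<Sum>i<j. a (r i)) + h P x"
    using Suc.IH[OF P(1) xP] by blast
  have "h Q x \<le> K * (\<Sum>i<j. a (r i)) + (h R x + K * a (r j))"
    using r(2,3) h[OF Pc P(2) Suc.prems(2)] by simp
  then have "h Q x \<le> K * (\<Sum>i<Suc j. a ((r(Suc j := R)) i)) + h R x"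
    by (simp add: distrib_left)
  then show ?case
    using r(1) Suc.prems by (intro exI[of _ "r(Suc j := R)"]) (auto simp: le_Suc_eq)
qed

end

section \<open>The weighted estimate\<close>

lemma sum_le_nn_integral_count_space:
  fixes f :: "'a \<Rightarrow> ennreal"
  assumes "finite A" "A \<subseteq> B"
  shows "(\<Sum>x\<in>A. f x) \<le> (\<integral>\<^sup>+x. f x \<partial>count_space B)"
proof -
  have "(\<integral>\<^sup>+x. f x * indicator A x \<partial>count_space B) = (\<Sum>x\<in>A. f x * indicator A x)"
    using assms by (intro nn_integral_count_space') auto
  also have "\<dots> = (\<Sum>x\<in>A. f x)"
    by (intro sum.cong) auto
  finally have "(\<Sum>x\<in>A. f x) = (\<integral>\<^sup>+x. f x * indicator A x \<partial>count_space B)" ..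
  also have "\<dots> \<le> (\<integral>\<^sup>+x. f x \<partial>count_space B)"
    by (intro nn_integral_mono) (auto simp: indicator_def)
  finally show ?thesis .
qed

lemma nn_integral_weight:
  assumes w: "weight w" and Q: "Q \<in> cubes"
  shows "(\<integral>\<^sup>+x. ennreal (indicator Q x * w x) \<partial>lebesgue) = ennreal (wmeasure w Q)"
proof -
  have "integrable lebesgue (\<lambda>x. indicator Q x * w x)"
    using locally_integrable_cubes[OF _ Q] w by (auto simp: weight_def set_integrable_def)
  then show ?thesis
    unfolding wmeasure_def set_lebesgue_integral_def real_scaleR_def
    using w by (intro nn_integral_eq_integral) (auto simp: weight_def)
qed

text \<open>Along the chain of stopping cubes around a point, the oscillation is at most
  \<open>K\<close> times the sum of the values of \<open>a\<close>. Jensen's inequality turns its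
  p-th power into a sum dominated by \<open>T\<close>; integrating \<open>T\<close> against
  \<open>w\<close> leaves one \<open>SD\<close> estimate per generation. The nonnegative integral is
  used so that finiteness, and thus integrability, is part of the conclusion.\<close>

lemma weighted_estimate:
  fixes f w :: "real^'n \<Rightarrow> real"
  assumes w: "weight w" "AE x in lebesgue. 0 < w x" and p: "1 \<le> p" and s: "1 < s"
    and a: "\<And>Q. Q \<in> cubes \<Longrightarrow> 0 < a Q" and SD: "SD_bound s p w a C" "0 \<le> C"
    and f: "locally_integrable f"
    and avg: "\<And>Q. Q \<in> cubes \<Longrightarrow> average Q (\<lambda>x. \<bar>f x - poly_proj m Q f x\<bar>) \<le> a Q"
    and M: "\<forall>Q\<in>cubes. \<forall>g\<in>poly_space m. \<forall>x\<in>Q. (g (x :: real^'n))\<^sup>2 \<le> M * average Q (\<lambda>x. g x * g x)" "0 \<le> M"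
    and Q: "Q \<in> cubes"
  defines "K \<equiv> exp 1 * (M * 2 ^ CARD('n) + 2)"
  shows "(\<integral>\<^sup>+x. ennreal (indicator Q x * (\<bar>f x - poly_proj m Q f x\<bar> powr p * w x)) \<partial>lebesgue)
    \<le> ennreal ((K * (1 + s) * C * a Q) powr p * wmeasure w Q)"
proof -
  define h where "h R x = \<bar>f x - poly_proj m R f x\<bar>" for R x
  \<comment> \<open>The ratio \<open>L\<close> of the decomposition is e: generation i then has
    relative measure at most e^(-i), and the condition \<open>SD\<close> yields powers of
    e^(-1/s).\<close>
  have e1: "1 < exp (1 :: real)" by simp
  have wpos: "\<And>Q. Q \<in> cubes \<Longrightarrow> 0 < wmeasure w Q"
    by (rule wmeasure_pos[OF w])
  have C1: "1 \<le> C"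
    by (rule SD_bound_ge_1[OF SD p s a wpos])
  have "\<forall>R\<in>cubes. \<exists>F. F \<subseteq> cubes \<and> countable F \<and> pairwise disjnt F \<and> (\<forall>R'\<in>F. R' \<subseteq> R) \<and>
    emeasure lebesgue (\<Union>F) \<le> ennreal (1 / exp 1) * emeasure lebesgue R \<and>
    (\<forall>R'\<in>F. \<forall>x\<in>R'. h R x \<le> h R' x + M * (2 ^ CARD('n) * (exp 1 * a R))) \<and>
    (AE x in lebesgue. x \<in> R - \<Union>F \<longrightarrow> h R x \<le> 2 * (exp 1 * a R))"
    (is "\<forall>R\<in>cubes. \<exists>F. ?P R F")
  proof
    fix R :: "(real^'n) set" assume R: "R \<in> cubes"
    obtain F where F: "F \<subseteq> cubes" "countable F" "pairwise disjnt F" "\<And>R'. R' \<in> F \<Longrightarrow> R' \<subseteq> R"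
      "emeasure lebesgue (\<Union>F) \<le> ennreal (1 / exp 1) * emeasure lebesgue R"
      "\<And>R' x. R' \<in> F \<Longrightarrow> x \<in> R' \<Longrightarrow> \<bar>f x - poly_proj m R f x\<bar>
        \<le> \<bar>f x - poly_proj m R' f x\<bar> + M * (2 ^ CARD('n) * (exp 1 * a R))"
      "AE x in lebesgue. x \<in> R - \<Union>F \<longrightarrow> \<bar>f x - poly_proj m R f x\<bar> \<le> 2 * (exp 1 * a R)"
      by (rule stopping_cubes[OF M f R a[OF R] avg[OF R] e1]) (rule that)
    then show "\<exists>F. ?P R F"
      unfolding h_def by (intro exI[of _ F] conjI ballI)
  qed
  from bchoice[OF this] obtain S where S': "\<forall>R\<in>cubes. ?P R (S R)"
    by blast
  have S: "\<And>R. R \<in> cubes \<Longrightarrow> S R \<subseteq> cubes" "\<And>R. R \<in> cubes \<Longrightarrow> countable (S R)"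
      "\<And>R. R \<in> cubes \<Longrightarrow> pairwise disjnt (S R)" "\<And>R R'. R \<in> cubes \<Longrightarrow> R' \<in> S R \<Longrightarrow> R' \<subseteq> R"
      "\<And>R. R \<in> cubes \<Longrightarrow> emeasure lebesgue (\<Union>(S R)) \<le> ennreal (1 / exp 1) * emeasure lebesgue R"
    and S_local: "\<And>R R' x. R \<in> cubes \<Longrightarrow> R' \<in> S R \<Longrightarrow> x \<in> R' \<Longrightarrow> h R x \<le> h R' x + M * (2 ^ CARD('n) * (exp 1 * a R))"
    and S_AE: "\<And>R. R \<in> cubes \<Longrightarrow> AE x in lebesgue. x \<in> R - \<Union>(S R) \<longrightarrow> h R x \<le> 2 * (exp 1 * a R)"
    using S' by (blast, blast, blast, blast, blast, blast, blast)
  define Gen where "Gen = generation S Q"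
  have Gen_cubes: "\<And>i R. R \<in> Gen i \<Longrightarrow> R \<in> cubes" and Gen_sub: "\<And>i R. R \<in> Gen i \<Longrightarrow> R \<subseteq> Q"
    and Gen_countable: "\<And>i. countable (Gen i)" and Gen_disj: "\<And>i. pairwise disjnt (Gen i)"
    and Gen_meas: "\<And>i. emeasure lebesgue (\<Union>(Gen i)) \<le> ennreal (1 / exp 1) ^ i * emeasure lebesgue Q"
    unfolding Gen_def
    using generation_cubes[OF S Q] generation_subset[OF S Q] generation_countable[OF S Q]
      generation_disjoint[OF S Q] generation_emeasure[OF S Q] by blast+
  define \<mu> where "\<mu> i = exp (- real i / s)" for i
  define D where "D = K powr p * (1 + s) powr (p - 1)"
  have D: "0 \<le> D" by (simp add: D_def)
  \<comment> \<open>The coefficients that Jensen's inequality with weights \<open>\<mu> i\<close> produces; since \<open>c i * \<mu> i powr p = D * \<mu> i\<close>,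
    the generations still add up to a geometric series.\<close>
  define c where "c i = D * \<mu> i powr (1 - p)" for i
  define b where "b = a Q powr p * wmeasure w Q"
  have b: "0 \<le> b" using wpos[OF Q] by (simp add: b_def)
  have K0: "0 < K"
    using M(2) unfolding K_def by (intro mult_pos_pos add_nonneg_pos mult_nonneg_nonneg) auto
  \<comment> \<open>One constant for both costs: passing from a cube to a child, and ending the
    chain at a point outside all children.\<close>
  have K: "M * (2 ^ CARD('n) * (exp 1 * t)) \<le> K * t" "2 * (exp 1 * t) \<le> K * t" if "0 \<le> t" for t
    using M(2) that by (auto simp: K_def algebra_simps)
  have \<mu>pos: "0 < \<mu> i" for i by (simp add: \<mu>_def)

  \<comment> \<open>For positive \<open>i\<close> this is \<open>SD\<close> with
    \<open>L = exp (real i)\<close>. Generation 0 would require L = 1, which \<open>SD\<close>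
    excludes; there the bound \<open>1 \<le> C\<close> is used instead.\<close>
  have level: "(\<Sum>R\<in>A. a R powr p * wmeasure w R) \<le> C powr p * \<mu> i powr p * b"
    if A: "finite A" "A \<subseteq> Gen i" for A i
  proof (cases i)
    case 0
    have "(\<Sum>R\<in>A. a R powr p * wmeasure w R) \<le> (\<Sum>R\<in>{Q}. a R powr p * wmeasure w R)"
      using A(2) 0 wpos[OF Q] by (intro sum_mono2) (auto simp: Gen_def)
    also have "\<dots> = 1 * b" by (simp add: b_def)
    also have "\<dots> \<le> C powr p * \<mu> i powr p * b"
      using C1 p b 0 by (intro mult_right_mono) (auto simp: \<mu>_def ge_one_powr_ge_zero)
    finally show ?thesis .
  next
    case (Suc k)
    have sets: "\<Union>(Gen i) \<in> sets lebesgue"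
      using Gen_cubes cubes_lebesgue by (intro sets.countable_Union Gen_countable) blast
    have "(\<Sum>R\<in>A. a R powr p * wmeasure w R)
        \<le> C powr p * (1 / exp (real i)) powr (p / s) * (a Q powr p * wmeasure w Q)"
    proof (rule SD_bound_finite[OF SD(1) Q _ A(1)])
      show "1 < exp (real i)" using Suc by simp
      show "A \<subseteq> cubes" using A(2) Gen_cubes by blast
      show "pairwise disjnt A" by (rule pairwise_subset[OF Gen_disj A(2)])
      show "R \<subseteq> Q" if "R \<in> A" for R using that A(2) Gen_sub by blast
      have "emeasure lebesgue (\<Union>A) \<le> emeasure lebesgue (\<Union>(Gen i))"
        using A(2) by (intro emeasure_mono sets) auto
      also note Gen_meas
      also have "ennreal (1 / exp 1) ^ i = ennreal (1 / exp (real i))"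
        by (simp add: ennreal_power power_divide flip: exp_of_nat_mult)
      finally show "emeasure lebesgue (\<Union>A) \<le> ennreal (1 / exp (real i)) * emeasure lebesgue Q" .
    qed
    also have "(1 / exp (real i)) powr (p / s) = \<mu> i powr p"
      by (simp add: \<mu>_def exp_powr_real inverse_eq_divide[symmetric] flip: exp_minus)
    finally show ?thesis by (simp only: b_def)
  qed

  \<comment> \<open>Cubes are indexed together with their generation, on which the coefficient
    \<open>c\<close> depends.\<close>
  define G where "G = (SIGMA i:UNIV. Gen i)"
  have G: "snd u \<in> cubes" "snd u \<subseteq> Q" if "u \<in> G" for u
    using that Gen_cubes Gen_sub unfolding G_def mem_Sigma_iff by (cases u; simp; blast)+
  have G_countable: "countable G"
    unfolding G_def by (intro countable_SIGMA Gen_countable) simp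
  \<comment> \<open>The sum over all stopping cubes containing \<open>x\<close>, written as an
    integral over a countable index set so that it can be interchanged with the integral in
    \<open>x\<close>.\<close>
  define T where "T x = (\<integral>\<^sup>+u. ennreal (c (fst u) * a (snd u) powr p) * indicator (snd u) x \<partial>count_space G)" for x
  have T_int: "(\<integral>\<^sup>+x. T x * ennreal (indicator Q x * w x) \<partial>lebesgue) \<le> ennreal (D * ((1 + s) * (C powr p * b)))"
  proof -
    have w_meas [measurable]: "w \<in> borel_measurable lebesgue"
      using w(1) locally_integrable_measurable unfolding weight_def by blast
    have "(\<integral>\<^sup>+x. T x * ennreal (indicator Q x * w x) \<partial>lebesgue)
       = (\<integral>\<^sup>+x. (\<integral>\<^sup>+u. ennreal (c (fst u) * a (snd u) powr p) * indicator (snd u) x * ennreal (indicator Q x * w x) \<partial>count_space G) \<partial>lebesgue)"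
      unfolding T_def by (intro nn_integral_cong nn_integral_multc[symmetric]) simp
    also have "\<dots> = (\<integral>\<^sup>+u. (\<integral>\<^sup>+x. ennreal (c (fst u) * a (snd u) powr p) * indicator (snd u) x * ennreal (indicator Q x * w x) \<partial>lebesgue) \<partial>count_space G)"
    proof (rule nn_integral_count_space_nn_integral[OF G_countable])
      fix u assume "u \<in> G"
      then have [measurable]: "snd u \<in> sets lebesgue" "Q \<in> sets lebesgue"
        using G(1) Q cubes_lebesgue by blast+
      show "(\<lambda>x. ennreal (c (fst u) * a (snd u) powr p) * indicator (snd u) x * ennreal (indicator Q x * w x)) \<in> borel_measurable lebesgue"
        by measurable
    qed
    also have "\<dots> \<le> ennreal (D * ((1 + s) * (C powr p * b)))"
    proof (rule nn_integral_count_space_le[OF G_countable])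
      fix A assume A: "finite A" "A \<subseteq> G"
      have 1: "(\<integral>\<^sup>+x. ennreal (c (fst u) * a (snd u) powr p) * indicator (snd u) x * ennreal (indicator Q x * w x) \<partial>lebesgue)
         = ennreal (c (fst u) * (a (snd u) powr p * wmeasure w (snd u)))" if u: "u \<in> A" for u
      proof -
        have uc: "snd u \<in> cubes" "snd u \<subseteq> Q"
          using u A(2) G by blast+
        have [measurable]: "snd u \<in> sets lebesgue"
          by (rule cubes_lebesgue[OF uc(1)])
        have "(\<integral>\<^sup>+x. ennreal (c (fst u) * a (snd u) powr p) * indicator (snd u) x * ennreal (indicator Q x * w x) \<partial>lebesgue)
          = (\<integral>\<^sup>+x. ennreal (c (fst u) * a (snd u) powr p) * ennreal (indicator (snd u) x * w x) \<partial>lebesgue)"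
          using uc(2) by (intro nn_integral_cong) (auto simp: indicator_def)
        also have "\<dots> = ennreal (c (fst u) * a (snd u) powr p) * (\<integral>\<^sup>+x. ennreal (indicator (snd u) x * w x) \<partial>lebesgue)"
          by (rule nn_integral_cmult) measurable
        also have "\<dots> = ennreal (c (fst u) * a (snd u) powr p) * ennreal (wmeasure w (snd u))"
          by (simp only: nn_integral_weight[OF w(1) uc(1)])
        also have "\<dots> = ennreal (c (fst u) * (a (snd u) powr p * wmeasure w (snd u)))"
          using wpos[OF uc(1)] by (subst ennreal_mult''[symmetric]) (simp_all add: mult.assoc)
        finally show ?thesis .
      qed
      \<comment> \<open>A finite set of indices involves only generations below \<open>N\<close>.
        Slicing it by generation makes \<open>level\<close> applicable to each slice and leaves a
        finite geometric sum.\<close>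
      define N where "N = Suc (Max (fst ` A))"
      define A' where "A' i = A `` {i}" for i
      have A': "finite (A' i)" "A' i \<subseteq> Gen i" for i
        using A by (auto simp: A'_def G_def)
      have "fst u < N" if "u \<in> A" for u
        using A(1) that by (auto simp: N_def less_Suc_eq_le)
      then have A_eq: "A = Sigma {..<N} A'"
        by (force simp: A'_def)
      have "(\<Sum>u\<in>A. c (fst u) * (a (snd u) powr p * wmeasure w (snd u)))
          = (\<Sum>i<N. \<Sum>R\<in>A' i. c i * (a R powr p * wmeasure w R))"
        using A' by (subst A_eq, subst sum.Sigma) (auto simp: case_prod_beta)
      also have "\<dots> = (\<Sum>i<N. c i * (\<Sum>R\<in>A' i. a R powr p * wmeasure w R))"
        by (simp only: sum_distrib_left)
      also have "\<dots> \<le> (\<Sum>i<N. c i * (C powr p * \<mu> i powr p * b))"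
        using level[OF A'] by (intro sum_mono mult_left_mono) (auto simp: c_def D)
      also have "\<dots> = (\<Sum>i<N. D * (\<mu> i * (C powr p * b)))"
      proof (intro sum.cong refl)
        fix i
        have "\<mu> i powr (1 - p) * \<mu> i powr p = \<mu> i"
          using \<mu>pos[of i] by (simp flip: powr_add)
        then show "c i * (C powr p * \<mu> i powr p * b) = D * (\<mu> i * (C powr p * b))"
          unfolding c_def by (metis mult.assoc mult.commute)
      qed
      also have "\<dots> = D * ((\<Sum>i<N. \<mu> i) * (C powr p * b))"
        by (simp only: sum_distrib_left sum_distrib_right)
      also have "\<dots> \<le> D * ((1 + s) * (C powr p * b))"
        unfolding \<mu>_def using b D by (intro mult_left_mono mult_right_mono sum_exp_le s) simp_all
      finally have "ennreal (\<Sum>u\<in>A. c (fst u) * (a (snd u) powr p * wmeasure w (snd u))) \<le> ennreal (D * ((1 + s) * (C powr p * b)))"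
        by (rule ennreal_leI)
      moreover have "ennreal (\<Sum>u\<in>A. c (fst u) * (a (snd u) powr p * wmeasure w (snd u)))
        = (\<Sum>u\<in>A. ennreal (c (fst u) * (a (snd u) powr p * wmeasure w (snd u))))"
      proof (rule sum_ennreal[symmetric])
        fix u assume "u \<in> A"
        then have "snd u \<in> cubes" using A(2) G(1) by blast
        then show "0 \<le> c (fst u) * (a (snd u) powr p * wmeasure w (snd u))"
          using wpos[of "snd u"] D by (simp add: c_def)
      qed
      ultimately show "(\<Sum>u\<in>A. \<integral>\<^sup>+x. ennreal (c (fst u) * a (snd u) powr p) * indicator (snd u) x * ennreal (indicator Q x * w x) \<partial>lebesgue)
         \<le> ennreal (D * ((1 + s) * (C powr p * b)))"
        by (simp only: 1 cong: sum.cong)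
    qed
    finally show ?thesis .
  qed

  \<comment> \<open>There are only countably many stopping cubes, so their exceptional null sets can
    be removed together.\<close>
  have "AE x in lebesgue. \<forall>i. \<forall>R\<in>Gen i. x \<in> R - \<Union>(S R) \<longrightarrow> h R x \<le> 2 * (exp 1 * a R)"
    unfolding AE_all_countable using Gen_cubes S_AE
    by (intro allI, subst AE_ball_countable[OF Gen_countable]) blast
  moreover have "AE x in lebesgue. \<exists>j. x \<notin> \<Union>(Gen j)"
    unfolding Gen_def by (rule AE_not_in_all_generations[OF S Q e1])
  ultimately have pointwise: "AE x in lebesgue. x \<in> Q \<longrightarrow> ennreal (h Q x powr p) \<le> T x"
  proof eventually_elim
    case (elim x)
    show ?case
    proof
      assume xQ: "x \<in> Q"
      \<comment> \<open>The first generation that misses \<open>x\<close>. It is not 0 because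
        \<open>x\<close> lies in \<open>Q\<close>; so \<open>x\<close> belongs to a cube
        \<open>R\<close> of the preceding generation but to no child of \<open>R\<close>, where the
        almost everywhere bound holds.\<close>
      define k where "k = (LEAST j. x \<notin> \<Union>(Gen j))"
      have k: "x \<notin> \<Union>(Gen k)" unfolding k_def using elim(2) by (rule LeastI_ex)
      have "k \<noteq> 0" using k xQ by (intro notI) (simp add: Gen_def)
      then obtain j where j: "k = Suc j" by (cases k) auto
      have "x \<in> \<Union>(Gen j)"
        using not_less_Least[of j "\<lambda>j. x \<notin> \<Union>(Gen j)"] j unfolding k_def[symmetric] by simp
      then obtain R where R: "R \<in> Gen j" "x \<in> R" by blast
      have "x \<notin> \<Union>(S R)"
        using k R(1) unfolding j Gen_def generation.simps by blast
      then have hR: "h R x \<le> 2 * (exp 1 * a R)"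
        using elim(1) R by blast
      have loc: "\<And>R R' x. R \<in> cubes \<Longrightarrow> R' \<in> S R \<Longrightarrow> x \<in> R' \<Longrightarrow> h R x \<le> h R' x + K * a R"
        using S_local K(1) a by (meson add_left_mono less_imp_le order_trans)
      obtain r where r: "\<forall>i\<le>j. r i \<in> Gen i \<and> x \<in> r i" "r j = R" "h Q x \<le> K * (\<Sum>i<j. a (r i)) + h R x"
        using generation_chain[where h = h and K = K and a = a, OF S Q loc R[unfolded Gen_def]] unfolding Gen_def by blast
      have ar: "0 < a (r i)" if "i < Suc j" for i
        using r(1) that Gen_cubes a by (meson less_Suc_eq_le)
      have "h R x \<le> K * a (r j)"
        unfolding r(2) using hR K(2)[OF less_imp_le[OF a[OF Gen_cubes[OF R(1)]]]] by (rule order_trans)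
      then have "h Q x \<le> K * (\<Sum>i<Suc j. a (r i))"
        using r(3) by (simp add: distrib_left)
      then have "h Q x powr p \<le> (K * (\<Sum>i<Suc j. a (r i))) powr p"
        using p by (intro powr_mono2) (auto simp: h_def)
      also have "\<dots> = K powr p * (\<Sum>i<Suc j. a (r i)) powr p"
        by (rule powr_mult)
      also have "\<dots> \<le> K powr p * ((1 + s) powr (p - 1) * (\<Sum>i<Suc j. \<mu> i powr (1 - p) * a (r i) powr p))"
        using p ar \<mu>pos sum_exp_le[OF s, of "Suc j"]
        by (intro mult_left_mono powr_sum_le_weighted) (auto simp: \<mu>_def)
      also have "\<dots> = (\<Sum>i<Suc j. c i * a (r i) powr p)"
        unfolding c_def D_def sum_distrib_left by (simp only: mult.assoc)
      finally have "ennreal (h Q x powr p) \<le> ennreal (\<Sum>i<Suc j. c i * a (r i) powr p)"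
        by (rule ennreal_leI)
      also have "\<dots> = (\<Sum>i<Suc j. ennreal (c i * a (r i) powr p))"
        by (rule sum_ennreal[symmetric]) (simp add: c_def D)
      also have "\<dots> = (\<Sum>u\<in>(\<lambda>i. (i, r i)) ` {..<Suc j}. ennreal (c (fst u) * a (snd u) powr p) * indicator (snd u) x)"
        using r(1) by (subst sum.reindex) (auto simp: inj_on_def less_Suc_eq_le intro!: sum.cong)
      also have "\<dots> \<le> T x"
        unfolding T_def using r(1) by (intro sum_le_nn_integral_count_space) (auto simp: G_def)
      finally show "ennreal (h Q x powr p) \<le> T x" .
    qed
  qed
  have "(\<integral>\<^sup>+x. ennreal (indicator Q x * (\<bar>f x - poly_proj m Q f x\<bar> powr p * w x)) \<partial>lebesgue)
    \<le> (\<integral>\<^sup>+x. T x * ennreal (indicator Q x * w x) \<partial>lebesgue)"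
  proof (rule nn_integral_mono_AE)
    show "AE x in lebesgue. ennreal (indicator Q x * (\<bar>f x - poly_proj m Q f x\<bar> powr p * w x))
        \<le> T x * ennreal (indicator Q x * w x)"
      using pointwise
    proof eventually_elim
      case (elim x)
      show ?case
      proof (cases "x \<in> Q")
        case True
        have "ennreal (indicator Q x * (\<bar>f x - poly_proj m Q f x\<bar> powr p * w x)) = ennreal (h Q x powr p) * ennreal (w x)"
          using True w(1) by (simp add: h_def weight_def ennreal_mult')
        also have "\<dots> \<le> T x * ennreal (w x)"
          using elim True by (intro mult_right_mono) auto
        finally show ?thesis using True by simp
      qed simp
    qed
  qed
  also note T_int
  \<comment> \<open>The power p - 1 of 1 + s from Jensen's inequality and the one further factor
    from the geometric series combine to the full p-th power.\<close>
  also have "D * ((1 + s) * (C powr p * b)) = (K * (1 + s) * C * a Q) powr p * wmeasure w Q"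
  proof -
    have "(1 + s) powr (p - 1) * (1 + s) = (1 + s) powr p"
      using s by (simp add: powr_diff)
    moreover have "(K * (1 + s) * C * a Q) powr p = K powr p * (1 + s) powr p * C powr p * a Q powr p"
      using K0 s SD(2) a[OF Q] by (simp add: powr_mult)
    ultimately show ?thesis
      unfolding b_def D_def by (metis mult.assoc)
  qed
  finally show ?thesis .
qed

theorem theorem1p24:
  fixes m :: nat
  shows "\<exists>C::real. \<forall>(w :: real^'n \<Rightarrow> real) (p::real) (s::real)
           (a :: (real^'n) set \<Rightarrow> real) (f :: real^'n \<Rightarrow> real).
     A_infinity w \<longrightarrow> 1 \<le> p \<longrightarrow> 1 < s \<longrightarrow>
     (\<forall>Q\<in>cubes. 0 < a Q) \<longrightarrow> SD s p w a \<longrightarrow>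
     locally_integrable f \<longrightarrow>
     (\<forall>Q\<in>cubes. average Q (\<lambda>x. \<bar>f x - poly_proj m Q f x\<bar>) \<le> a Q) \<longrightarrow>
     (\<forall>Q\<in>cubes.
        set_integrable lebesgue Q (\<lambda>x. \<bar>f x - poly_proj m Q f x\<bar> powr p * w x) \<and>
        (1 / wmeasure w Q *
           (LINT x:Q|lebesgue. \<bar>f x - poly_proj m Q f x\<bar> powr p * w x)) powr (1 / p)
          \<le> C * (if p = 1 then 1 else 2 powr ((s + 1) / (p / (p - 1)))) * s
              * SD_norm s p w a powr s * a Q)"
proof -
  obtain M0 where M0: "\<forall>Q\<in>cubes. \<forall>g\<in>poly_space m. \<forall>x\<in>Q. (g (x :: real^'n))\<^sup>2 \<le> M0 * average Q (\<lambda>x. g x * g x)"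
    using poly_space_sup_average_bound by blast
  \<comment> \<open>Enlarging the constant keeps the bound, since a mean square is
    nonnegative.\<close>
  define M where "M = max M0 0"
  have M: "\<forall>Q\<in>cubes. \<forall>g\<in>poly_space m. \<forall>x\<in>Q. (g (x :: real^'n))\<^sup>2 \<le> M * average Q (\<lambda>x. g x * g x)" "0 \<le> M"
    using M0 mult_right_mono[OF max.cobounded1[of M0 0] average_sq_nonneg]
    unfolding M_def by (blast intro: order_trans, simp)
  define K where "K = exp 1 * (M * 2 ^ CARD('n) + 2)"
  have K: "0 < K"
    using M(2) unfolding K_def by (intro mult_pos_pos add_nonneg_pos mult_nonneg_nonneg) auto
  show ?thesis
  \<comment> \<open>\<open>K\<close> is built from n and m alone; the factor 2 absorbs
    \<open>1 + s \<le> 2 * s\<close>.\<close>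
  proof (intro exI[of _ "2 * K"] allI impI ballI)
    fix w :: "real^'n \<Rightarrow> real" and p s :: real and a f and Q :: "(real^'n) set"
    assume A: "A_infinity w" and p: "1 \<le> p" and s: "1 < s" and a: "\<forall>Q\<in>cubes. 0 < a Q" and SD: "SD s p w a"
      and f: "locally_integrable f"
      and avg: "\<forall>Q\<in>cubes. average Q (\<lambda>x. \<bar>f x - poly_proj m Q f x\<bar>) \<le> a Q"
      and Q: "Q \<in> cubes"
    note w = A_infinity_weight[OF A] A_infinity_pos[OF A]
    have wpos: "\<And>Q. Q \<in> cubes \<Longrightarrow> 0 < wmeasure w Q"
      by (rule wmeasure_pos[OF w])
    have aQ: "0 < a Q" using a Q by blast
    \<comment> \<open>The admissible constants, whose infimum is \<open>SD_norm\<close>. The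
      hypothesis \<open>SD\<close> makes this set nonempty, so that the infimum is
      meaningful.\<close>
    define S where "S = {C. 0 \<le> C \<and> SD_bound s p w a C}"
    have S: "S \<noteq> {}" using SD by (auto simp: S_def SD_def)
    define F where "F x = \<bar>f x - poly_proj m Q f x\<bar> powr p * w x" for x
    have F0: "0 \<le> F x" for x using w(1) by (simp add: F_def weight_def)
    have bound: "(\<integral>\<^sup>+x. ennreal (indicator Q x * F x) \<partial>lebesgue)
        \<le> ennreal ((K * (1 + s) * C * a Q) powr p * wmeasure w Q)" if "C \<in> S" for C
      unfolding F_def K_def using that a avg
      by (intro weighted_estimate[OF w p s _ _ _ f _ M Q]) (auto simp: S_def)
    have F_meas: "(\<lambda>x. indicator Q x * F x) \<in> borel_measurable lebesgue"
    proof -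
      have [measurable]: "f \<in> borel_measurable lebesgue" "w \<in> borel_measurable lebesgue"
        "poly_proj m Q f \<in> borel_measurable lebesgue" "Q \<in> sets lebesgue"
        using f w(1) locally_integrable_measurable poly_space_lebesgue[OF poly_proj_in_poly_space[OF Q]]
          cubes_lebesgue[OF Q] unfolding weight_def by blast+
      show ?thesis unfolding F_def by measurable
    qed
    obtain C0 where "C0 \<in> S" using S by blast
    \<comment> \<open>Any single admissible constant already gives a finite integral.\<close>
    have int: "integrable lebesgue (\<lambda>x. indicator Q x * F x)"
      using F_meas F0 le_less_trans[OF bound[OF \<open>C0 \<in> S\<close>] ennreal_less_top]
      by (intro integrableI_nonneg) auto
    define I where "I = (LINT x:Q|lebesgue. F x)"
    have I0: "0 \<le> I"
      unfolding I_def set_lebesgue_integral_def using F0 by (intro Bochner_Integration.integral_nonneg) simp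
    have I: "(1 / wmeasure w Q * I) powr (1 / p) \<le> K * (1 + s) * a Q * C" if C: "C \<in> S" for C
    proof -
      let ?B = "K * (1 + s) * C * a Q"
      have B: "0 \<le> ?B" using K s C aQ by (auto simp: S_def)
      have "ennreal I \<le> ennreal (?B powr p * wmeasure w Q)"
        using bound[OF C] F0 unfolding I_def set_lebesgue_integral_def real_scaleR_def
        by (subst nn_integral_eq_integral[symmetric, OF int]) auto
      then have "I \<le> ?B powr p * wmeasure w Q"
        using wpos[OF Q] by (subst (asm) ennreal_le_iff) auto
      then have "1 / wmeasure w Q * I \<le> ?B powr p"
        using wpos[OF Q] by (simp add: pos_divide_le_eq)
      then have "(1 / wmeasure w Q * I) powr (1 / p) \<le> (?B powr p) powr (1 / p)"
        using I0 wpos[OF Q] p by (intro powr_mono2) auto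
      also have "\<dots> = ?B"
        using p B by (simp add: powr_powr)
      finally show ?thesis by (simp only: mult_ac)
    qed
    define N where "N = SD_norm s p w a"
    have N: "N = Inf S" by (simp add: N_def SD_norm_def S_def)
    have "1 \<le> C" if "C \<in> S" for C
      using that a SD_bound_ge_1[OF _ _ p s _ wpos, of a C] by (auto simp: S_def)
    then have N1: "1 \<le> N"
      unfolding N using S by (intro cInf_greatest) auto
    \<comment> \<open>Dividing by the other factors makes the estimate a lower bound for every
      admissible constant, hence for their infimum; attainment of the infimum does not
      enter.\<close>
    have "(1 / wmeasure w Q * I) powr (1 / p) / (K * (1 + s) * a Q) \<le> N"
      unfolding N using S I K s aQ by (intro cInf_greatest) (auto simp: pos_divide_le_eq mult.commute)
    then have "(1 / wmeasure w Q * I) powr (1 / p) \<le> K * (1 + s) * a Q * N"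
      using K s aQ by (simp add: pos_divide_le_eq mult.commute)
    also have "\<dots> \<le> K * (2 * s) * a Q * N powr s"
    proof (intro mult_mono)
      \<comment> \<open>The step from the first power of the norm to the power \<open>s\<close>
        relies on \<open>1 \<le> N\<close>.\<close>
      show "N \<le> N powr s" using powr_mono[of 1 s N] s N1 by simp
    qed (use K s aQ N1 in auto)
    also have "\<dots> = (2 * K * s * N powr s * a Q) * 1" by simp
    \<comment> \<open>For p > 1 the exponent is positive, so the inserted power of 2 is at least
      1.\<close>
    also have "\<dots> \<le> (2 * K * s * N powr s * a Q) * (if p = 1 then 1 else 2 powr ((s + 1) / (p / (p - 1))))"
      using K s aQ p by (intro mult_left_mono) (auto intro!: ge_one_powr_ge_zero)
    also have "\<dots> = 2 * K * (if p = 1 then 1 else 2 powr ((s + 1) / (p / (p - 1)))) * s * N powr s * a Q"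
      by (simp only: mult_ac)
    finally have le: "(1 / wmeasure w Q * I) powr (1 / p)
      \<le> 2 * K * (if p = 1 then 1 else 2 powr ((s + 1) / (p / (p - 1)))) * s * N powr s * a Q" .
    show "set_integrable lebesgue Q (\<lambda>x. \<bar>f x - poly_proj m Q f x\<bar> powr p * w x) \<and>
        (1 / wmeasure w Q *
           (LINT x:Q|lebesgue. \<bar>f x - poly_proj m Q f x\<bar> powr p * w x)) powr (1 / p)
          \<le> 2 * K * (if p = 1 then 1 else 2 powr ((s + 1) / (p / (p - 1)))) * s
              * SD_norm s p w a powr s * a Q"
      using int le unfolding set_integrable_def I_def N_def F_def real_scaleR_def by blast
  qed
qed

end
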